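(* Let $n$, $k\ge 3$ and $s\ge 2$ be integers with $n\ge 2sk+38s^4$. Then the number of subfamilies of $\binom{[n]}{k}$ with no matching of size $s$ is $$\left(\binom{n}{s-1}+o(1)\right)2^{\binom{n}{k}-\binom{n-s+1}{k}},$$ where the term $o(1)$ tends to $0$ as $n\to\infty$.
   Context: $\binom{[n]}{k}$ is the family of all $k$-element subsets of $[n]=\{1,\dots,n\}$. A matching of size $s$ in a set family is a collection of $s$ pairwise disjoint members of the family. The asymptotic statement is as $n\to\infty$, where $k$ and $s$ are allowed to vary with $n$ subject to the stated constraints (so the $o(1)$ term is bounded in absolute value by a function of $n$ alone tending to $0$). *)

theory Defs
  imports Complex_Main "HOL-Library.Ramsey" "HOL-Library.Disjoint_Sets"
begin

definition is_matching :: "'a set set \<Rightarrow> nat \<Rightarrow> 'a set set \<Rightarrow> bool" where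
  "is_matching F s M \<longleftrightarrow> M \<subseteq> F \<and> finite M \<and> card M = s \<and> pairwise disjnt M"

definition matching_free_families :: "nat \<Rightarrow> nat \<Rightarrow> nat \<Rightarrow> nat set set set" where
  "matching_free_families n k s =
     {F. F \<subseteq> nsets {1..n} k \<and> (\<nexists>M. is_matching F s M)}"

end

theory Submission
  imports Defs "HOL-Combinatorics.Permutations"
begin

text \<open>
Put \<open>t = s - 1\<close> and \<open>N = (n choose k) - ((n - t) choose k)\<close>. The families all of whose members
meet a fixed \<open>t\<close>-set number \<open>2 ^ N\<close> for each of the \<open>n choose t\<close> choices of the \<open>t\<close>-set, and the
overlaps between different choices are negligible.

The remaining families lie in maximal ones that have no \<open>t\<close>-cover. A maximal family is the set of all
\<open>k\<close>-sets meeting every member of a minimal system of unions of \<open>t\<close>-matchings; by the Bollobas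
set-pairs inequality that system has at most \<open>(s * k) choose k\<close> members, so there are at most
\<open>2 ^ ((n + 1) * ((s * k) choose k))\<close> maximal families. Such a family misses the size \<open>N\<close> by at least
\<open>((n - s - (k - 1)) choose (k - 1)) / (s + 1)\<close>, which is at least twice that exponent.

This stability bound follows Frankl's argument for the matching conjecture. Shift the family to the
left. If it becomes shifted without acquiring a cover of size \<open>t\<close>, the links of the first \<open>s\<close> points form a
chain of cross-dependent families and the sets missing these points are controlled by the shadow
bound \<open>card F \<le> t * card (shadow F)\<close>. If some shift creates a \<open>t\<close>-cover, then the family
had a cover \<open>U\<close> of size \<open>s\<close> already, and its links at the points of \<open>U\<close> are nonempty and
cross-dependent. Averaging over random packings of \<open>2 * t + 2\<close> disjoint sets bounds the links in both
cases.
\<close>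

section \<open>Averaging over permutations\<close>

lemma card_nsets: "finite V \<Longrightarrow> card (nsets V k) = card V choose k"
  using n_subsets[of V k] by (simp add: nsets_def finite_subset cong: conj_cong)

lemma permutes_extending_image:
  assumes "finite V" "A \<in> nsets V l" "B \<in> nsets V l"
  obtains p where "p permutes V" "p ` A = B"
proof -
  have sub: "A \<subseteq> V" "B \<subseteq> V" and fin: "finite A" "finite B" and c: "card A = card B"
    using assms by (auto simp: nsets_def)
  obtain f where f: "bij_betw f A B" using c fin finite_same_card_bij by blast
  have "card (V - A) = card (V - B)" using sub c fin by (simp add: card_Diff_subset)
  then obtain g where g: "bij_betw g (V - A) (V - B)"
    using assms(1) finite_same_card_bij by blast
  define p where "p x = (if x \<in> A then f x else if x \<in> V then g x else x)" for x
  have "bij_betw p A B" using f by (rule bij_betw_cong[THEN iffD1, rotated]) (simp add: p_def)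
  moreover have "bij_betw p (V - A) (V - B)"
    using g by (rule bij_betw_cong[THEN iffD1, rotated]) (simp add: p_def)
  ultimately have "bij_betw p (A \<union> (V - A)) (B \<union> (V - B))"
    by (rule bij_betw_combine) auto
  then have "bij_betw p V V" using sub by (simp add: Un_absorb1)
  moreover have "p x = x" if "x \<notin> V" for x using that sub by (auto simp: p_def)
  ultimately have "p permutes V" by (rule bij_imp_permutes)
  moreover have "p ` A = B" using \<open>bij_betw p A B\<close> by (simp add: bij_betw_def)
  ultimately show ?thesis using that by blast
qed

lemma permutes_image_nsets: "p permutes V \<Longrightarrow> A \<in> nsets V l \<Longrightarrow> p ` A \<in> nsets V l"
  by (auto simp: nsets_def permutes_in_image card_image[OF inj_on_subset[OF permutes_inj]])

text \<open>A random permutation of \<open>V\<close> sends the fixed set \<open>B\<close> to a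
  uniformly distributed \<open>l\<close>-set: composing on the left with a permutation that takes
  \<open>A\<close> to \<open>A'\<close> matches the two fibres.\<close>

lemma card_permutes_image:
  assumes V: "finite V" and A: "A \<in> nsets V l" and B: "B \<in> nsets V l"
  shows "card {p. p permutes V \<and> p ` B = A} * (card V choose l) = card {p. p permutes V}"
proof -
  have const: "card {p. p permutes V \<and> p ` B = A'} = card {p. p permutes V \<and> p ` B = A}"
    if A': "A' \<in> nsets V l" for A'
  proof -
    obtain q where q: "q permutes V" "q ` A = A'"
      using permutes_extending_image[OF V A A'] .
    have "bij_betw (\<lambda>p. q \<circ> p) {p. p permutes V \<and> p ` B = A} {p. p permutes V \<and> p ` B = A'}"
    proof (rule bij_betwI[where g = "\<lambda>p. inv q \<circ> p"])
      show "(\<lambda>p. q \<circ> p) \<in> {p. p permutes V \<and> p ` B = A} \<rightarrow> {p. p permutes V \<and> p ` B = A'}"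
        using q by (auto intro: permutes_compose simp: image_comp[symmetric])
      show "(\<lambda>p. inv q \<circ> p) \<in> {p. p permutes V \<and> p ` B = A'} \<rightarrow> {p. p permutes V \<and> p ` B = A}"
      proof (rule funcsetI, clarify)
        fix p assume p: "p permutes V" "A' = p ` B"
        have "p ` B = q ` A" using p q by simp
        then have "(inv q \<circ> p) ` B = A"
          unfolding image_comp[symmetric]
          by (simp only: image_inv_f_f[OF permutes_inj[OF q(1)]])
        then show "inv q \<circ> p permutes V \<and> (inv q \<circ> p) ` B = A"
          using p permutes_compose[OF _ permutes_inv[OF q(1)]] by blast
      qed
    qed (use q in \<open>auto simp: fun_eq_iff permutes_inverses\<close>)
    then show ?thesis by (simp add: bij_betw_same_card)
  qed
  have "card {p. p permutes V} = card (\<Union>A'\<in>nsets V l. {p. p permutes V \<and> p ` B = A'})"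
    using permutes_image_nsets[OF _ B] by (intro arg_cong[where f = card]) auto
  also have "\<dots> = (\<Sum>A'\<in>nsets V l. card {p. p permutes V \<and> p ` B = A'})"
    using V by (intro card_UN_disjoint) (auto simp: finite_imp_finite_nsets
        intro: finite_subset[OF _ finite_permutations[OF V]])
  also have "\<dots> = (\<Sum>A'\<in>nsets V l. card {p. p permutes V \<and> p ` B = A})"
    using const by (intro sum.cong) auto
  finally show ?thesis using V by (simp add: card_nsets)
qed

text \<open>Katona-style averaging. A random permutation puts \<open>B q\<close> into
  \<open>F q\<close> with probability \<open>card (F q) / (card V choose l)\<close>, so an
  inequality valid for every permutation passes to these probabilities. The sets \<open>B q\<close>
  may repeat, so one set can be tested against several families.\<close>

lemma sum_card_le_permutes_average:
  fixes c :: nat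
  assumes V: "finite V" and "finite Q"
    and B: "\<And>q. q \<in> Q \<Longrightarrow> B q \<in> nsets V l" and F: "\<And>q. q \<in> Q \<Longrightarrow> F q \<subseteq> nsets V l"
    and le: "\<And>p. p permutes V \<Longrightarrow> (\<Sum>q\<in>Q. w q * of_bool (p ` B q \<in> F q)) \<le> c"
  shows "(\<Sum>q\<in>Q. w q * card (F q)) \<le> c * (card V choose l)"
proof -
  let ?P = "{p. p permutes V}"
  have finP: "finite ?P" using V by (rule finite_permutations)
  have "id \<in> ?P" by (simp add: permutes_id)
  then have Ppos: "card ?P > 0" using finP card_gt_0_iff by blast
  have hits: "(\<Sum>p\<in>?P. of_bool (p ` B q \<in> F q)) * (card V choose l) = card (F q) * card ?P"
    if q: "q \<in> Q" for q
  proof -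
    have "finite (F q)" using F[OF q] V by (meson finite_imp_finite_nsets finite_subset)
    have "(\<Sum>p\<in>?P. of_bool (p ` B q \<in> F q)) = card {p\<in>?P. p ` B q \<in> F q}"
      using finP by (simp add: of_bool_def sum.If_cases Int_def)
    also have "{p\<in>?P. p ` B q \<in> F q} = (\<Union>A\<in>F q. {p. p permutes V \<and> p ` B q = A})" by auto
    also have "card \<dots> = (\<Sum>A\<in>F q. card {p. p permutes V \<and> p ` B q = A})"
      using \<open>finite (F q)\<close> by (intro card_UN_disjoint) (auto intro: finite_subset[OF _ finP])
    finally have "(\<Sum>p\<in>?P. of_bool (p ` B q \<in> F q)) * (card V choose l) =
      (\<Sum>A\<in>F q. card {p. p permutes V \<and> p ` B q = A} * (card V choose l))"
      by (simp add: sum_distrib_right)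
    also have "\<dots> = (\<Sum>A\<in>F q. card ?P)"
      using F[OF q] by (intro sum.cong refl card_permutes_image[OF V _ B[OF q]]) auto
    finally show ?thesis by simp
  qed
  have "(\<Sum>q\<in>Q. w q * card (F q)) * card ?P =
      (\<Sum>q\<in>Q. w q * ((\<Sum>p\<in>?P. of_bool (p ` B q \<in> F q)) * (card V choose l)))"
    by (subst sum_distrib_right, intro sum.cong refl) (simp only: hits mult.assoc)
  also have "\<dots> = (\<Sum>p\<in>?P. \<Sum>q\<in>Q. w q * of_bool (p ` B q \<in> F q)) * (card V choose l)"
    by (subst sum.swap) (simp add: sum_distrib_left sum_distrib_right mult.assoc)
  also have "\<dots> \<le> (\<Sum>p\<in>?P. c) * (card V choose l)"
    using le by (intro mult_right_mono sum_mono) auto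
  finally have "(\<Sum>q\<in>Q. w q * card (F q)) * card ?P \<le> (c * (card V choose l)) * card ?P"
    by (simp add: ac_simps)
  then show ?thesis using Ppos by simp
qed

section \<open>Cross-dependent families and random packings\<close>

text \<open>In other words, there is no rainbow matching. Disjointness is by index, so for a
  constant tuple with finite \<open>I\<close>, and a family without the empty set, this says that
  the family has no matching of size \<open>card I\<close>.\<close>

definition cross_dependent :: "'i set \<Rightarrow> ('i \<Rightarrow> 'a set set) \<Rightarrow> bool" where
  "cross_dependent I G \<longleftrightarrow> \<not> (\<exists>f. (\<forall>u\<in>I. f u \<in> G u) \<and> disjoint_family_on f I)"

lemma cross_dependentD:
  "cross_dependent I G \<Longrightarrow> (\<And>u. u \<in> I \<Longrightarrow> f u \<in> G u) \<Longrightarrow> disjoint_family_on f I \<Longrightarrow> False"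
  unfolding cross_dependent_def by (erule notE, rule exI[of _ f]) simp

text \<open>Choose in increasing order: when \<open>p\<close> is reached, only \<open>p\<close>
  values are taken, so \<open>S p\<close> still has a free one.\<close>

lemma greedy_representatives:
  assumes "\<And>p. p < s \<Longrightarrow> p < card (S p)"
  shows "\<exists>g. inj_on g {..<s} \<and> (\<forall>p<s. g p \<in> S p)"
  using assms
proof (induction s)
  case (Suc s)
  then obtain g where g: "inj_on g {..<s}" "\<forall>p<s. g p \<in> S p" by auto
  have "card (g ` {..<s}) \<le> s" using card_image_le[of "{..<s}" g] by simp
  then have "\<not> S s \<subseteq> g ` {..<s}"
    using Suc.prems[of s] card_mono[of "g ` {..<s}" "S s"] by fastforce
  then obtain x where x: "x \<in> S s" "x \<notin> g ` {..<s}" by blast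
  have "inj_on (g(s := x)) {..<Suc s}"
    using g(1) x(2) unfolding lessThan_Suc by (auto simp: inj_on_def)
  moreover have "\<forall>p<Suc s. (g(s := x)) p \<in> S p" using g(2) x(1) by (auto simp: less_Suc_eq)
  ultimately show ?case by blast
qed auto

lemma disjoint_nsets_exist:
  assumes "finite V" "r * l \<le> card V"
  shows "\<exists>B. (\<forall>j<r. B j \<in> nsets V l) \<and> disjoint_family_on B {..<r}"
  using assms
proof (induction r arbitrary: V)
  case (Suc r)
  then obtain A where A: "A \<subseteq> V" "card A = l"
    by (metis add_leD1 mult_Suc obtain_subset_with_card_n)
  have fA: "finite A" using A Suc.prems finite_subset by blast
  then have "r * l \<le> card (V - A)" using A Suc.prems by (simp add: card_Diff_subset)
  then obtain B where B: "\<forall>j<r. B j \<in> nsets (V - A) l" "disjoint_family_on B {..<r}"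
    using Suc.IH[of "V - A"] Suc.prems by auto
  have "\<forall>j<Suc r. (B(r := A)) j \<in> nsets V l"
    using A B(1) fA by (auto simp: less_Suc_eq nsets_def)
  moreover have "disjoint_family_on (B(r := A)) {..<Suc r}"
    using B unfolding disjoint_family_on_def nsets_def
    by (auto simp: less_Suc_eq)  blast+
  ultimately show ?case by blast
qed (auto simp: disjoint_family_on_def)

lemma disjoint_family_on_image_permutes:
  "p permutes V \<Longrightarrow> disjoint_family_on B I \<Longrightarrow> disjoint_family_on (\<lambda>i. p ` B i) I"
  by (auto simp: disjoint_family_on_def image_Int[OF permutes_inj, symmetric])

text \<open>In every permuted copy of a packing of \<open>t\<close> disjoint sets, cross-dependence
  makes at least one of the \<open>t\<close> membership tests fail; averaging does the rest.\<close>

lemma sum_card_cross_dependent: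
  assumes V: "finite V" "t * l \<le> card V" and "0 < t"
    and F: "\<And>i. i < t \<Longrightarrow> F i \<subseteq> nsets V l" and cd: "cross_dependent {..<t} F"
  shows "(\<Sum>i<t. card (F i)) + (card V choose l) \<le> t * (card V choose l)"
proof -
  obtain B where B: "\<forall>j<t. B j \<in> nsets V l" "disjoint_family_on B {..<t}"
    using disjoint_nsets_exist[OF V] by blast
  have "(\<Sum>i<t. 1 * card (F i)) \<le> (t - 1) * (card V choose l)"
  proof (rule sum_card_le_permutes_average[OF V(1), where B = B])
    fix p assume p: "p permutes V"
    have "\<not> (\<forall>i\<in>{..<t}. p ` B i \<in> F i)"
      using cross_dependentD[OF cd, of "\<lambda>i. p ` B i"]
        disjoint_family_on_image_permutes[OF p B(2)] by blast
    then obtain i where i: "i < t" "p ` B i \<notin> F i" by auto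
    have "(\<Sum>i<t. 1 * of_bool (p ` B i \<in> F i)) = card {i\<in>{..<t}. p ` B i \<in> F i}"
      by (simp add: of_bool_def sum.If_cases Int_def)
    also have "\<dots> \<le> card ({..<t} - {i})" using i by (intro card_mono) auto
    also have "\<dots> = t - 1" using i by simp
    finally show "(\<Sum>i<t. 1 * of_bool (p ` B i \<in> F i)) \<le> t - 1" .
  qed (use B F in auto)
  then show ?thesis using \<open>0 < t\<close> by (cases t) auto
qed

text \<open>
The weight \<open>t + 2\<close> on the smallest family exceeds by one what the shadow bound consumes; this surplus
is what produces the deficit in \<open>chain_sum_deficit\<close>.
\<close>

lemma chain_weighted_sum_le:
  assumes V: "finite V" "(2 * t + 2) * l \<le> card V"
    and H: "\<And>i. i \<le> t \<Longrightarrow> H i \<subseteq> nsets V l"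
    and chain: "\<And>i j. i \<le> j \<Longrightarrow> j \<le> t \<Longrightarrow> H i \<subseteq> H j"
    and cd: "cross_dependent {..t} H"
  shows "(\<Sum>i=1..t. card (H i)) + (t + 2) * card (H 0) \<le> t * (card V choose l)"
proof -
  define r where "r = 2 * t + 2"
  obtain B where B: "\<forall>j<r. B j \<in> nsets V l" "disjoint_family_on B {..<r}"
    using disjoint_nsets_exist[OF V] unfolding r_def by blast
  define w where "w i = (if i = 0 then t + 2 else 1)" for i :: nat
  have split0: "(\<Sum>i\<le>t. w i * x i) = (\<Sum>i=1..t. x i) + (t + 2) * x 0" for x :: "nat \<Rightarrow> nat"
  proof -
    have "{..t} = insert 0 {1..t}" by auto
    then show ?thesis by (simp add: w_def)
  qed
  have "(\<Sum>q\<in>{..t} \<times> {..<r}. w (fst q) * card (H (fst q))) \<le> (t * r) * (card V choose l)"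
  proof (rule sum_card_le_permutes_average[OF V(1), where B = "\<lambda>q. B (snd q)"])
    fix p assume p: "p permutes V"
    define S where "S i = {j\<in>{..<r}. p ` B j \<in> H i}" for i
    \<comment> \<open>Otherwise the greedy choice picks distinct blocks for all the families, and
      distinct blocks are disjoint.\<close>
    have "\<exists>i\<le>t. card (S i) \<le> i"
    proof (rule ccontr)
      assume "\<not> ?thesis"
      then have "\<And>i. i < Suc t \<Longrightarrow> i < card (S i)" by (metis less_Suc_eq_le not_le)
      from greedy_representatives[OF this] obtain g where
        g: "inj_on g {..<Suc t}" "\<forall>i<Suc t. g i \<in> S i" by blast
      have "disjoint_family_on (\<lambda>i. p ` B (g i)) {..t}"
        unfolding disjoint_family_on_def
      proof (intro ballI impI)
        fix i j assume "i \<in> {..t}" "j \<in> {..t}" "i \<noteq> j"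
        then have "g i \<noteq> g j" "g i \<in> {..<r}" "g j \<in> {..<r}"
          using g by (auto simp: S_def less_Suc_eq_le dest: inj_onD)
        then show "p ` B (g i) \<inter> p ` B (g j) = {}"
          using disjoint_family_on_image_permutes[OF p B(2)] by (simp add: disjoint_family_on_def)
      qed
      moreover have "\<forall>i\<in>{..t}. p ` B (g i) \<in> H i" using g(2) by (auto simp: S_def)
      ultimately show False
        using cross_dependentD[OF cd, of "\<lambda>i. p ` B (g i)"] by blast
    qed
    then obtain i0 where i0: "i0 \<le> t" "card (S i0) \<le> i0" by blast
    have low: "card (S i) \<le> i0" if "i \<le> i0" for i
    proof -
      have "S i \<subseteq> S i0" using chain[OF that i0(1)] by (auto simp: S_def)
      then have "card (S i) \<le> card (S i0)" by (intro card_mono) (auto simp: S_def)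
      then show ?thesis using i0 by simp
    qed
    have high: "card (S i) \<le> r" for i
      using card_mono[of "{..<r}" "S i"] by (auto simp: S_def)
    have "{1..t} = {1..i0} \<union> {i0+1..t}" using i0 by auto
    then have "(\<Sum>i=1..t. card (S i)) = (\<Sum>i=1..i0. card (S i)) + (\<Sum>i=i0+1..t. card (S i))"
      by (simp add: sum.union_disjoint)
    also have "\<dots> \<le> (\<Sum>i=1..i0. i0) + (\<Sum>i=i0+1..t. r)"
      using low high by (intro add_mono sum_mono) auto
    finally have "(\<Sum>i=1..t. card (S i)) + (t + 2) * card (S 0)
        \<le> i0 * i0 + (t - i0) * r + (t + 2) * i0"
      using low[of 0] by (simp add: add_mono mult_left_mono)
    also have "\<dots> = (t - i0) * r + i0 * (i0 + t + 2)" by (simp add: algebra_simps)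
    \<comment> \<open>As \<open>i0 <= t\<close>, the factor \<open>i0 + t + 2\<close> is at most
      \<open>2 * t + 2\<close>; this fixes the packing size \<open>r\<close>.\<close>
    also have "\<dots> \<le> (t - i0) * r + i0 * r"
      using i0(1) by (intro add_mono mult_left_mono) (auto simp: r_def)
    also have "\<dots> = t * r" using i0(1) by (simp add: add_mult_distrib[symmetric])
    finally have "(\<Sum>i\<le>t. w i * card (S i)) \<le> t * r" by (simp only: split0)
    moreover have "(\<Sum>q\<in>{..t} \<times> {..<r}. w (fst q) * of_bool (p ` B (snd q) \<in> H (fst q)))
        = (\<Sum>i\<le>t. w i * card (S i))"
      by (simp add: sum.cartesian_product' sum_distrib_left[symmetric] S_def
          of_bool_def sum.If_cases Int_def)
    ultimately show "(\<Sum>q\<in>{..t} \<times> {..<r}. w (fst q) * of_bool (p ` B (snd q) \<in> H (fst q))) \<le> t * r"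
      by simp
  qed (use B H in \<open>auto intro: subsetD[OF H]\<close>)
  also have "(\<Sum>q\<in>{..t} \<times> {..<r}. w (fst q) * card (H (fst q)))
      = r * (\<Sum>i\<le>t. w i * card (H i))"
    by (simp add: sum.cartesian_product' sum_distrib_left)
  finally have "r * (\<Sum>i\<le>t. w i * card (H i)) \<le> r * (t * (card V choose l))"
    by (simp add: ac_simps)
  moreover have "0 < r" by (simp add: r_def)
  ultimately have "(\<Sum>i\<le>t. w i * card (H i)) \<le> t * (card V choose l)" by simp
  then show ?thesis by (simp only: split0)
qed

text \<open>Two bounds are added: \<open>t + 1\<close> times \<open>chain_weighted_sum_le\<close>,
  and one for \<open>H 1\<close> to \<open>H t\<close> alone. For the latter, fix \<open>B\<close>
  in \<open>H 0\<close>; the members of \<open>H 1\<close>, ..., \<open>H t\<close> disjoint from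
  \<open>B\<close> form a cross-dependent \<open>t\<close>-tuple on \<open>V - B\<close>, which
  costs one full copy of \<open>nsets (V - B) l\<close>.\<close>

lemma chain_sum_deficit:
  assumes V: "finite V" "(2 * t + 2) * l \<le> card V" and "0 < t"
    and H: "\<And>i. i \<le> t \<Longrightarrow> H i \<subseteq> nsets V l"
    and chain: "\<And>i j. i \<le> j \<Longrightarrow> j \<le> t \<Longrightarrow> H i \<subseteq> H j"
    and cd: "cross_dependent {..t} H" and ne: "H 0 \<noteq> {}"
  shows "(t + 2) * ((\<Sum>i=1..t. card (H i)) + (t + 1) * card (H 0)) + ((card V - l) choose l)
    \<le> (t + 2) * (t * (card V choose l))"
proof -
  obtain B where B: "B \<in> H 0" using ne by blast
  have BV: "B \<subseteq> V" "finite B" "card B = l" using B H[of 0] by (auto simp: nsets_def)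
  have cVB: "card (V - B) = card V - l" using BV by (simp add: card_Diff_subset)
  define F where "F i = H (Suc i) \<inter> nsets (V - B) l" for i
  have "cross_dependent {..<t} F"
    unfolding cross_dependent_def
  proof
    assume "\<exists>f. (\<forall>u\<in>{..<t}. f u \<in> F u) \<and> disjoint_family_on f {..<t}"
    then obtain f where f: "\<And>u. u < t \<Longrightarrow> f u \<in> F u" "disjoint_family_on f {..<t}" by auto
    define g where "g i = (case i of 0 \<Rightarrow> B | Suc j \<Rightarrow> f j)" for i
    have "g i \<in> H i" if "i \<le> t" for i
      using that B f(1) by (cases i) (auto simp: g_def F_def)
    moreover have "disjoint_family_on g {..t}"
      unfolding disjoint_family_on_def
    proof (intro ballI impI)
      fix i j assume ij: "i \<in> {..t}" "j \<in> {..t}" "i \<noteq> j"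
      have fB: "f u \<inter> B = {}" "B \<inter> f u = {}" if "u < t" for u using f(1)[OF that] by (auto simp: F_def nsets_def)
      show "g i \<inter> g j = {}"
        using ij f(2)
        by (auto simp: g_def disjoint_family_on_def fB split: nat.splits)
    qed
    ultimately show False using cd unfolding cross_dependent_def by auto
  qed
  then have "(\<Sum>i<t. card (F i)) + (card (V - B) choose l) \<le> t * (card (V - B) choose l)"
    using V \<open>0 < t\<close>
    by (intro sum_card_cross_dependent) (auto simp: F_def[abs_def] cVB algebra_simps)
  \<comment> \<open>Passing from \<open>H (Suc i)\<close> to \<open>F i\<close> loses only
    \<open>l\<close>-sets that meet \<open>B\<close>.\<close>
  moreover have "card (H (Suc i)) + (card (V - B) choose l) \<le> card (F i) + (card V choose l)"
    if "i < t" for i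
  proof -
    have fin: "finite (nsets V l)" "finite (nsets (V - B) l)"
      using V by (auto simp: finite_imp_finite_nsets)
    have Hs: "H (Suc i) \<subseteq> nsets V l" using H that by simp
    have fH: "finite (H (Suc i))" using Hs fin finite_subset by blast
    have "card (H (Suc i)) + card (nsets (V - B) l) =
        card (H (Suc i) \<union> nsets (V - B) l) + card (F i)"
      unfolding F_def using fH fin by (rule_tac card_Un_Int) auto
    also have "card (H (Suc i) \<union> nsets (V - B) l) \<le> card (nsets V l)"
      using Hs fin by (intro card_mono) (auto simp: nsets_def)
    finally show ?thesis using V by (simp add: card_nsets)
  qed
  then have "(\<Sum>i<t. card (H (Suc i)) + (card (V - B) choose l)) \<le>
      (\<Sum>i<t. card (F i) + (card V choose l))" by (intro sum_mono) auto
  ultimately have 2: "(\<Sum>i<t. card (H (Suc i))) + (card (V - B) choose l) \<le> t * (card V choose l)"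
    by (simp add: sum.distrib)
  have eq: "(\<Sum>i<t. card (H (Suc i))) = (\<Sum>i=1..t. card (H i))"
    by (rule sum.reindex_bij_witness[where i = "\<lambda>i. i - 1" and j = Suc]) auto
  \<comment> \<open>Together with the second bound the weights become
    \<open>(t + 1) * (t + 2)\<close> on \<open>H 0\<close> and \<open>t + 2\<close> on every other
    family.\<close>
  have "(t + 1) * ((\<Sum>i=1..t. card (H i)) + (t + 2) * card (H 0)) \<le> (t + 1) * (t * (card V choose l))"
    using chain_weighted_sum_le[OF V H chain cd] by (intro mult_left_mono) auto
  then show ?thesis using 2 unfolding eq cVB by (simp add: algebra_simps)
qed

section \<open>Shifting\<close>

text \<open>The compression of Erdos, Ko and Rado, replacing \<open>j\<close> by \<open>i\<close>.
  It refers to \<open>F\<close> because a set whose image is already present stays put, which keeps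
  the map injective on \<open>F\<close>.\<close>

definition shift_set :: "nat \<Rightarrow> nat \<Rightarrow> nat set set \<Rightarrow> nat set \<Rightarrow> nat set" where
  "shift_set i j F A =
    (if j \<in> A \<and> i \<notin> A \<and> insert i (A - {j}) \<notin> F then insert i (A - {j}) else A)"

definition shift :: "nat \<Rightarrow> nat \<Rightarrow> nat set set \<Rightarrow> nat set set" where
  "shift i j F = shift_set i j F ` F"

lemma inj_on_shift_set: "inj_on (shift_set i j F) F"
proof (rule inj_onI)
  fix A B assume A: "A \<in> F" "B \<in> F" and eq: "shift_set i j F A = shift_set i j F B"
  show "A = B"
  proof (cases "shift_set i j F A = A \<or> shift_set i j F B = B")
    case True
    then show ?thesis using A eq by (auto simp: shift_set_def split: if_splits)
  next
    case False
    then have *: "j \<in> A" "i \<notin> A" "j \<in> B" "i \<notin> B" "insert i (A - {j}) = insert i (B - {j})"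
      using eq by (auto simp: shift_set_def split: if_splits)
    then have "A - {j} = B - {j}" by (metis Diff_iff insert_ident)
    then show ?thesis using * by (metis insert_Diff)
  qed
qed

lemma card_shift: "card (shift i j F) = card F"
  unfolding shift_def by (rule card_image[OF inj_on_shift_set])

lemma shift_subset_nsets:
  assumes "F \<subseteq> nsets V k" "i \<in> V"
  shows "shift i j F \<subseteq> nsets V k"
proof -
  have "shift_set i j F A \<in> nsets V k" if "A \<in> F" for A
  proof -
    have A: "A \<subseteq> V" "finite A" "card A = k" using assms(1) that by (auto simp: nsets_def)
    moreover have "card (insert i (A - {j})) = k" if "j \<in> A" "i \<notin> A"
      using A that card_Suc_Diff1[of A j] by simp
    ultimately show ?thesis using assms(2) by (auto simp: shift_set_def nsets_def)
  qed
  then show ?thesis by (auto simp: shift_def)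
qed

lemma shift_newD:
  assumes "B \<in> shift i j F" "B \<notin> F"
  shows "i \<in> B \<and> (i \<noteq> j \<longrightarrow> j \<notin> B \<and> insert j (B - {i}) \<in> F)"
proof -
  obtain A where A: "A \<in> F" "B = shift_set i j F A" using assms(1) by (auto simp: shift_def)
  then have *: "j \<in> A" "i \<notin> A" "B = insert i (A - {j})"
    using assms(2) by (auto simp: shift_set_def split: if_splits)
  then have "insert j (B - {i}) = A" by auto
  then show ?thesis using * A(1) by simp
qed

lemma shift_oldD:
  assumes "B \<in> shift i j F" "j \<in> B" "i \<notin> B"
  shows "insert i (B - {j}) \<in> F"
proof -
  obtain A where "A \<in> F" "B = shift_set i j F A" using assms(1) by (auto simp: shift_def)
  then show ?thesis using assms(2,3) by (auto simp: shift_set_def split: if_splits)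
qed

text \<open>A set that is new in a shifted family contains \<open>i\<close>, so a disjoint tuple has
  at most one. Undo the shift there, which turns \<open>i\<close> into \<open>j\<close>, and
  exchange \<open>j\<close> for \<open>i\<close> in the member that held \<open>j\<close>, if any;
  by \<open>shift_oldD\<close> the latter stays in its original family. The result is a disjoint
  tuple of unshifted members.\<close>

lemma cross_dependent_shift:
  assumes cd: "cross_dependent I G" and ij: "i \<noteq> j"
  shows "cross_dependent I (\<lambda>u. shift i j (G u))"
  unfolding cross_dependent_def
proof
  assume "\<exists>f. (\<forall>u\<in>I. f u \<in> shift i j (G u)) \<and> disjoint_family_on f I"
  then obtain f where f0: "\<forall>u\<in>I. f u \<in> shift i j (G u)" "disjoint_family_on f I" by blast
  have f: "f u \<in> shift i j (G u)" if "u \<in> I" for u using f0(1) that by blast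
  have dj: "f u \<inter> f v = {}" if "u \<in> I" "v \<in> I" "u \<noteq> v" for u v
    using f0(2) that by (simp add: disjoint_family_on_def)
  show False
  proof (cases "\<forall>u\<in>I. f u \<in> G u")
    case True
    then show False using cross_dependentD[OF cd, of f] dj by (auto simp: disjoint_family_on_def)
  next
    case False
    then obtain u where u: "u \<in> I" "f u \<notin> G u" by blast
    have fu: "i \<in> f u" "j \<notin> f u" "insert j (f u - {i}) \<in> G u"
      using shift_newD[OF f[OF u(1)] u(2)] ij by auto
    have i_only: "i \<notin> f v" if "v \<in> I" "v \<noteq> u" for v using dj[OF u(1) that(1)] that fu(1) by auto
    have old: "f v \<in> G v" if "v \<in> I" "v \<noteq> u" for v
      using shift_newD[OF f[OF that(1)]] i_only[OF that] by blast
    define g where "g v = (if v = u then insert j (f u - {i})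
      else if j \<in> f v then insert i (f v - {j}) else f v)" for v
    have "g v \<in> G v" if "v \<in> I" for v
      using that fu(3) old shift_oldD[OF f[OF that]] i_only[OF that] by (auto simp: g_def)
    moreover have "disjoint_family_on g I"
      unfolding disjoint_family_on_def
    proof (intro ballI impI)
      fix v w assume vw: "v \<in> I" "w \<in> I" "v \<noteq> w"
      have D: "x \<notin> f v \<or> x \<notin> f w" for x using dj[OF vw] by blast
      show "g v \<inter> g w = {}"
        using D D[of j] D[of i] i_only[OF vw(1)] i_only[OF vw(2)] vw(3) fu ij
        by (auto simp: g_def split: if_splits)
    qed
    ultimately show False using cross_dependentD[OF cd, of g] by blast
  qed
qed

text \<open>The element sum is the potential of the later inductions: with \<open>i < j\<close> a
  shift never raises it, and lowers it when a set moves.\<close>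

lemma sum_shift_set_le: "i < j \<Longrightarrow> finite A \<Longrightarrow> \<Sum>(shift_set i j F A) \<le> \<Sum>A"
  and sum_shift_set_less: "i < j \<Longrightarrow> finite A \<Longrightarrow> j \<in> A \<Longrightarrow> i \<notin> A \<Longrightarrow> insert i (A - {j}) \<notin> F
    \<Longrightarrow> \<Sum>(shift_set i j F A) < \<Sum>A"
proof -
  have *: "\<Sum>(insert i (A - {j})) < \<Sum>A" if "i < j" "finite A" "j \<in> A" "i \<notin> A"
    using that sum.remove[of A j id] by simp
  show "i < j \<Longrightarrow> finite A \<Longrightarrow> \<Sum>(shift_set i j F A) \<le> \<Sum>A"
    using * by (auto simp: shift_set_def less_imp_le)
  show "i < j \<Longrightarrow> finite A \<Longrightarrow> j \<in> A \<Longrightarrow> i \<notin> A \<Longrightarrow> insert i (A - {j}) \<notin> F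
    \<Longrightarrow> \<Sum>(shift_set i j F A) < \<Sum>A"
    using * by (auto simp: shift_set_def)
qed

lemma weight_shift_le:
  assumes "i < j" "F \<subseteq> nsets V k" "finite V"
  shows "(\<Sum>A\<in>shift i j F. \<Sum>A) \<le> (\<Sum>A\<in>F. \<Sum>A)"
proof -
  have "finite A" if "A \<in> F" for A using assms(2) that by (auto simp: nsets_def)
  then show ?thesis unfolding shift_def
    by (subst sum.reindex[OF inj_on_shift_set]) (auto intro!: sum_mono sum_shift_set_le assms)
qed

lemma weight_shift_less:
  assumes "i < j" "F \<subseteq> nsets V k" "finite V"
    and A: "A \<in> F" "j \<in> A" "i \<notin> A" "insert i (A - {j}) \<notin> F"
  shows "(\<Sum>A\<in>shift i j F. \<Sum>A) < (\<Sum>A\<in>F. \<Sum>A)"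
proof -
  have fin: "finite A" if "A \<in> F" for A using assms(2) that by (auto simp: nsets_def)
  have "finite F" using assms by (meson finite_imp_finite_nsets finite_subset)
  then have "(\<Sum>A\<in>F. \<Sum>(shift_set i j F A)) < (\<Sum>A\<in>F. \<Sum>A)"
    using fin A \<open>i < j\<close>
    by (intro sum_strict_mono_ex1 ballI bexI[of _ A] sum_shift_set_le sum_shift_set_less) auto
  then show ?thesis unfolding shift_def by (subst sum.reindex[OF inj_on_shift_set]) simp
qed

section \<open>Left-shifted families and the deficit of cross-dependent tuples\<close>

definition left_shifted :: "nat set \<Rightarrow> nat set set \<Rightarrow> bool" where
  "left_shifted V F \<longleftrightarrow>
    (\<forall>A\<in>F. \<forall>i\<in>V. \<forall>j\<in>A. i < j \<longrightarrow> i \<notin> A \<longrightarrow> insert i (A - {j}) \<in> F)"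

lemma left_shiftedD:
  "left_shifted V F \<Longrightarrow> A \<in> F \<Longrightarrow> i \<in> V \<Longrightarrow> j \<in> A \<Longrightarrow> i < j \<Longrightarrow> i \<notin> A \<Longrightarrow> insert i (A - {j}) \<in> F"
  by (auto simp: left_shifted_def)

text \<open>A member of least element sum works: exchanging one of its elements for a smaller
  missing point of \<open>V\<close> would stay in \<open>F\<close> and lower the sum. With
  \<open>initial_segment_unique\<close>, nonempty left-shifted families of \<open>l\<close>-sets
  have this member in common.\<close>

lemma left_shifted_has_initial_segment:
  assumes "left_shifted V F" "F \<subseteq> nsets V l" "F \<noteq> {}"
  shows "\<exists>A\<in>F. \<forall>x\<in>A. \<forall>y\<in>V. y < x \<longrightarrow> y \<in> A"
proof -
  obtain A where A: "A \<in> F" "\<And>B. B \<in> F \<Longrightarrow> \<Sum>A \<le> \<Sum>B"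
    using ex_has_least_nat[of "\<lambda>A. A \<in> F" _ "\<lambda>A. \<Sum>A"] assms(3) by blast
  have fA: "finite A" using A(1) assms(2) by (auto simp: nsets_def)
  have "y \<in> A" if "x \<in> A" "y \<in> V" "y < x" for x y
  proof (rule ccontr)
    assume "y \<notin> A"
    then have "insert y (A - {x}) \<in> F" using left_shiftedD[OF assms(1) A(1)] that by blast
    moreover have "\<Sum>(insert y (A - {x})) < \<Sum>A"
      using that fA \<open>y \<notin> A\<close> sum.remove[of A x id] by simp
    ultimately show False using A(2) by fastforce
  qed
  then show ?thesis using A(1) by blast
qed

lemma initial_segment_unique:
  fixes A B :: "nat set"
  assumes "A \<in> nsets V l" "B \<in> nsets V l"
    and A: "\<forall>x\<in>A. \<forall>y\<in>V. y < x \<longrightarrow> y \<in> A" and B: "\<forall>x\<in>B. \<forall>y\<in>V. y < x \<longrightarrow> y \<in> B"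
  shows "A = B"
proof -
  have AV: "A \<subseteq> V" "B \<subseteq> V" "finite A" "finite B" "card A = card B"
    using assms(1,2) by (auto simp: nsets_def)
  have "A \<subseteq> B \<or> B \<subseteq> A"
  proof (rule ccontr)
    assume "\<not> ?thesis"
    then obtain x y where "x \<in> A" "x \<notin> B" "y \<in> B" "y \<notin> A" by blast
    then show False using A B AV by (metis linorder_less_linear subsetD)
  qed
  then show ?thesis using AV by (metis card_subset_eq)
qed

text \<open>
Replacing a cross-dependent tuple by its layers (sets lying in at least \<open>t + 1 - i\<close> of the families)
turns it into a chain with the same total size.
\<close>

lemma cross_dependent_layers:
  assumes U: "finite U" "card U = Suc t" and cd: "cross_dependent U G"
  shows "cross_dependent {..t} (\<lambda>i. {A\<in>X. t + 1 - i \<le> card {u\<in>U. A \<in> G u}})"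
  unfolding cross_dependent_def
proof
  assume "\<exists>f. (\<forall>i\<in>{..t}. f i \<in> {A\<in>X. t + 1 - i \<le> card {u\<in>U. A \<in> G u}}) \<and> disjoint_family_on f {..t}"
  then obtain f where f: "\<And>i. i \<le> t \<Longrightarrow> t + 1 - i \<le> card {u\<in>U. f i \<in> G u}"
    and dj: "disjoint_family_on f {..t}" by auto
  \<comment> \<open>In reversed order, \<open>f (t - p)\<close> lies in at least
    \<open>p + 1\<close> families, so distinct indices can be assigned greedily.\<close>
  have "p < card {u\<in>U. f (t - p) \<in> G u}" if "p < Suc t" for p using f[of "t - p"] that by auto
  from greedy_representatives[OF this] obtain g where
    g: "inj_on g {..<Suc t}" "\<And>p. p < Suc t \<Longrightarrow> g p \<in> U \<and> f (t - p) \<in> G (g p)" by blast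
  have "g ` {..<Suc t} = U"
    using g U by (intro card_subset_eq) (auto simp: card_image)
  then have bij: "bij_betw g {..<Suc t} U" using g(1) by (simp add: bij_betw_def)
  define h where "h = inv_into {..<Suc t} g"
  have h: "h u < Suc t" "g (h u) = u" if "u \<in> U" for u
    using bij_betw_inv_into_right[OF bij that] bij_betw_apply[OF bij_betw_inv_into[OF bij] that]
    by (auto simp: h_def)
  have "f (t - h u) \<in> G u" if "u \<in> U" for u using g(2)[OF h(1)[OF that]] h(2)[OF that] by simp
  moreover have "disjoint_family_on (\<lambda>u. f (t - h u)) U"
    unfolding disjoint_family_on_def
  proof (intro ballI impI)
    fix u v assume uv: "u \<in> U" "v \<in> U" "u \<noteq> v"
    then have "h u \<noteq> h v" by (metis h(2))
    then have "t - h u \<noteq> t - h v" using h(1)[OF uv(1)] h(1)[OF uv(2)] by auto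
    then show "f (t - h u) \<inter> f (t - h v) = {}" using dj by (auto simp: disjoint_family_on_def)
  qed
  ultimately show False using cross_dependentD[OF cd, of "\<lambda>u. f (t - h u)"] by blast
qed

text \<open>Summing the multiplicities \<open>c A\<close> shows that the layers \<open>H i\<close>
  have the same total size as the families. The layers form a cross-dependent chain, and the common
  member \<open>P\<close> makes \<open>H 0\<close> nonempty, so \<open>chain_sum_deficit\<close>
  applies.\<close>

lemma cross_dependent_common_set:
  assumes V: "finite V" "(2 * t + 2) * l \<le> card V" and "0 < t"
    and U: "finite U" "card U = Suc t"
    and G: "\<And>u. u \<in> U \<Longrightarrow> G u \<subseteq> nsets V l" and cd: "cross_dependent U G"
    and P: "P \<in> nsets V l" "\<And>u. u \<in> U \<Longrightarrow> P \<in> G u"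
  shows "(t + 2) * (\<Sum>u\<in>U. card (G u)) + ((card V - l) choose l) \<le> (t + 2) * (t * (card V choose l))"
proof -
  define c where "c A = card {u\<in>U. A \<in> G u}" for A
  define H where "H i = {A\<in>nsets V l. t + 1 - i \<le> c A}" for i
  have finV: "finite (nsets V l)" using V by (simp add: finite_imp_finite_nsets)
  have c_le: "c A \<le> Suc t" for A using U card_mono[of U "{u\<in>U. A \<in> G u}"] by (auto simp: c_def)
  have "(\<Sum>u\<in>U. card (G u)) = (\<Sum>u\<in>U. \<Sum>A\<in>nsets V l. of_bool (A \<in> G u))"
    using G finV by (intro sum.cong refl) (simp add: of_bool_def sum.If_cases Int_absorb1)
  also have "\<dots> = (\<Sum>A\<in>nsets V l. c A)"
    using U by (subst sum.swap) (simp add: of_bool_def sum.If_cases c_def Int_def)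
  also have "\<dots> = (\<Sum>A\<in>nsets V l. \<Sum>i\<le>t. of_bool (t + 1 - i \<le> c A))"
  proof (intro sum.cong refl)
    fix A
    have "(\<Sum>i\<le>t. of_bool (t + 1 - i \<le> c A)) = card {i\<in>{..t}. t + 1 - i \<le> c A}"
      by (simp add: of_bool_def sum.If_cases Int_def)
    also have "{i\<in>{..t}. t + 1 - i \<le> c A} = {t + 1 - c A..t}" by auto
    also have "card \<dots> = c A" using c_le[of A] by simp
    finally show "c A = (\<Sum>i\<le>t. of_bool (t + 1 - i \<le> c A))" by simp
  qed
  also have "\<dots> = (\<Sum>i\<le>t. card (H i))"
    using finV by (subst sum.swap) (simp add: of_bool_def sum.If_cases H_def Int_def)
  also have "{..t} = insert 0 {1..t}" by auto
  finally have "(\<Sum>u\<in>U. card (G u)) \<le> (\<Sum>i=1..t. card (H i)) + (t + 1) * card (H 0)" by simp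
  then have "(t + 2) * (\<Sum>u\<in>U. card (G u)) \<le> (t + 2) * ((\<Sum>i=1..t. card (H i)) + (t + 1) * card (H 0))"
    by (rule mult_left_mono) simp
  moreover have "(t + 2) * ((\<Sum>i=1..t. card (H i)) + (t + 1) * card (H 0)) + ((card V - l) choose l)
    \<le> (t + 2) * (t * (card V choose l))"
  proof (rule chain_sum_deficit[OF V \<open>0 < t\<close>])
    show "cross_dependent {..t} H"
      using cross_dependent_layers[OF U cd, of "nsets V l"] by (simp add: H_def[abs_def] c_def)
    have "{u\<in>U. P \<in> G u} = U" using P by auto
    then show "H 0 \<noteq> {}" using P U by (auto simp: H_def c_def)
  qed (auto simp: H_def)
  ultimately show ?thesis by linarith
qed

text \<open>Shift all families simultaneously until each is left-shifted. Sizes, nonemptiness and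
  cross-dependence survive while the total element sum falls; at the end the initial segment of
  \<open>V\<close> of size \<open>l\<close> is a common member.\<close>

lemma cross_dependent_sum_deficit:
  fixes G :: "'i \<Rightarrow> nat set set"
  assumes V: "finite V" "(2 * t + 2) * l \<le> card V" and "0 < t"
    and U: "finite U" "card U = Suc t"
    and "\<And>u. u \<in> U \<Longrightarrow> G u \<subseteq> nsets V l" and "cross_dependent U G"
    and "\<And>u. u \<in> U \<Longrightarrow> G u \<noteq> {}"
  shows "(t + 2) * (\<Sum>u\<in>U. card (G u)) + ((card V - l) choose l) \<le> (t + 2) * (t * (card V choose l))"
  using assms(6-8)
proof (induction "\<Sum>u\<in>U. \<Sum>A\<in>G u. \<Sum>A" arbitrary: G rule: less_induct)
  case (less G)
  show ?case
  proof (cases "\<forall>u\<in>U. left_shifted V (G u)")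
    case True
    have seg: "\<exists>A\<in>G u. \<forall>x\<in>A. \<forall>y\<in>V. y < x \<longrightarrow> y \<in> A" if "u \<in> U" for u
      using True that less.prems(1)[OF that] less.prems(3)[OF that]
      by (intro left_shifted_has_initial_segment) auto
    obtain u0 where u0: "u0 \<in> U" using U by fastforce
    obtain P where P: "P \<in> G u0" "\<forall>x\<in>P. \<forall>y\<in>V. y < x \<longrightarrow> y \<in> P" using seg[OF u0] by blast
    have PV: "P \<in> nsets V l" using less.prems(1) u0 P by blast
    have PG: "P \<in> G u" if "u \<in> U" for u
    proof -
      obtain A where A: "A \<in> G u" "\<forall>x\<in>A. \<forall>y\<in>V. y < x \<longrightarrow> y \<in> A" using seg[OF \<open>u \<in> U\<close>] by blast
      then have "A \<in> nsets V l" using less.prems(1) that by blast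
      then have "P = A" using initial_segment_unique[OF PV _ P(2) A(2)] by simp
      then show ?thesis using A by simp
    qed
    show ?thesis
      by (rule cross_dependent_common_set[OF V \<open>0 < t\<close> U less.prems(1,2) PV PG])
  next
    case False
    then obtain u A i j where u: "u \<in> U" and ij: "i \<in> V" "i < j"
      and A: "A \<in> G u" "j \<in> A" "i \<notin> A" "insert i (A - {j}) \<notin> G u"
      unfolding left_shifted_def by blast
    have "(\<Sum>u\<in>U. \<Sum>A\<in>shift i j (G u). \<Sum>A) < (\<Sum>u\<in>U. \<Sum>A\<in>G u. \<Sum>A)"
    proof (rule sum_strict_mono_ex1[OF U(1)])
      show "\<forall>x\<in>U. (\<Sum>A\<in>shift i j (G x). \<Sum>A) \<le> (\<Sum>A\<in>G x. \<Sum>A)"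
        using weight_shift_le[OF ij(2) less.prems(1) V(1)] by blast
      show "\<exists>x\<in>U. (\<Sum>A\<in>shift i j (G x). \<Sum>A) < (\<Sum>A\<in>G x. \<Sum>A)"
        using weight_shift_less[OF ij(2) less.prems(1)[OF u] V(1) A] u by blast
    qed
    then have "(t + 2) * (\<Sum>u\<in>U. card (shift i j (G u))) + ((card V - l) choose l)
        \<le> (t + 2) * (t * (card V choose l))"
    proof (rule less.hyps)
      show "shift i j (G u) \<subseteq> nsets V l" if "u \<in> U" for u
        using less.prems(1)[OF that] ij(1) by (rule shift_subset_nsets)
      show "cross_dependent U (\<lambda>u. shift i j (G u))"
        using less.prems(2) ij(2) by (intro cross_dependent_shift) auto
      show "shift i j (G u) \<noteq> {}" if "u \<in> U" for u
        using less.prems(3)[OF that] by (simp add: shift_def)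
    qed
    then show ?thesis by (simp add: card_shift)
  qed
qed

section \<open>Shadows and links\<close>

lemma cross_dependent_reindex:
  assumes h: "bij_betw h J I" and cd: "cross_dependent I G"
  shows "cross_dependent J (\<lambda>j. G (h j))"
  unfolding cross_dependent_def
proof
  assume "\<exists>f. (\<forall>u\<in>J. f u \<in> G (h u)) \<and> disjoint_family_on f J"
  then obtain f where f: "\<forall>u\<in>J. f u \<in> G (h u)" "disjoint_family_on f J" by blast
  define g where "g = inv_into J h"
  have g: "g u \<in> J" "h (g u) = u" if "u \<in> I" for u
    using bij_betw_inv_into_right[OF h that] bij_betw_apply[OF bij_betw_inv_into[OF h] that]
    by (auto simp: g_def)
  have "f (g u) \<in> G u" if "u \<in> I" for u using f(1) g[OF that] by force
  moreover have "disjoint_family_on (\<lambda>u. f (g u)) I"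
    unfolding disjoint_family_on_def
  proof (intro ballI impI)
    fix u v assume uv: "u \<in> I" "v \<in> I" "u \<noteq> v"
    then have "g u \<noteq> g v" by (metis g(2))
    then show "f (g u) \<inter> f (g v) = {}"
      using f(2) g(1)[OF uv(1)] g(1)[OF uv(2)] by (simp add: disjoint_family_on_def)
  qed
  ultimately show False using cross_dependentD[OF cd, of "\<lambda>u. f (g u)"] by blast
qed

lemma cross_dependent_mono:
  assumes "cross_dependent I G" "\<And>u. u \<in> I \<Longrightarrow> H u \<subseteq> G u"
  shows "cross_dependent I H"
  using assms unfolding cross_dependent_def by (metis subsetD)

definition shadow :: "'a set set \<Rightarrow> 'a set set" where
  "shadow F = {A - {x} |A x. A \<in> F \<and> x \<in> A}"

lemma shadow_subset_nsets: "F \<subseteq> nsets V k \<Longrightarrow> shadow F \<subseteq> nsets V (k - 1)"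
  by (auto simp: shadow_def nsets_def)

text \<open>Double counting: each member yields \<open>k\<close> pairs of a shadow set and a deleted
  point, and that point is one of the \<open>card V - (k - 1)\<close> points outside the shadow
  set.\<close>

lemma card_le_shadow:
  assumes V: "finite V" and F: "F \<subseteq> nsets V k" and k: "0 < k"
  shows "card F * k \<le> card (shadow F) * (card V + 1 - k)"
proof -
  have finF: "finite F" using F V by (meson finite_imp_finite_nsets finite_subset)
  have S: "shadow F \<subseteq> nsets V (k - 1)" using F by (rule shadow_subset_nsets)
  have finS: "finite (shadow F)" using S V by (meson finite_imp_finite_nsets finite_subset)
  have A: "A \<subseteq> V" "finite A" "card A = k" if "A \<in> F" for A using F that by (auto simp: nsets_def)
  have B: "B \<subseteq> V" "finite B" "card B = k - 1" if "B \<in> shadow F" for B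
    using S that by (auto simp: nsets_def)
  have "card F * k = card (SIGMA A:F. A)"
    using finF A by (subst card_SigmaI) auto
  also have "\<dots> \<le> card (SIGMA B:shadow F. V - B)"
  proof (rule card_inj_on_le[where f = "\<lambda>(A, x). (A - {x}, x)"])
    show "inj_on (\<lambda>(A, x). (A - {x}, x)) (SIGMA A:F. A)"
      by (auto simp: inj_on_def)
    show "(\<lambda>(A, x). (A - {x}, x)) ` (SIGMA A:F. A) \<subseteq> (SIGMA B:shadow F. V - B)"
      using A(1) by (auto simp: shadow_def)
    show "finite (SIGMA B:shadow F. V - B)" using finS V by auto
  qed
  also have "\<dots> = (\<Sum>B\<in>shadow F. card (V - B))" using finS V by (subst card_SigmaI) auto
  also have "\<dots> = (\<Sum>B\<in>shadow F. card V + 1 - k)"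
    using B k by (intro sum.cong refl) (simp add: card_Diff_subset)
  finally show ?thesis by simp
qed

lemma card_cross_dependent_singletons:
  assumes V: "finite V" and F: "F \<subseteq> nsets V 1" and cd: "cross_dependent {..t} (\<lambda>_. F)"
  shows "card F \<le> t"
proof (rule ccontr)
  assume "\<not> card F \<le> t"
  then have "card {..t} \<le> card F" by simp
  moreover have "finite F" using F V by (meson finite_imp_finite_nsets finite_subset)
  ultimately obtain f where f: "f ` {..t} \<subseteq> F" "inj_on f {..t}"
    using card_le_inj[of "{..t}" F] by blast
  have "disjoint_family_on f {..t}"
    unfolding disjoint_family_on_def
  proof (intro ballI impI)
    fix i j assume ij: "i \<in> {..t}" "j \<in> {..t}" "i \<noteq> j"
    then have "f i \<noteq> f j" "f i \<in> nsets V 1" "f j \<in> nsets V 1"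
      using f F by (auto dest: inj_onD)
    then show "f i \<inter> f j = {}" by (auto simp: nsets_def card_Suc_eq)
  qed
  then show False using cross_dependentD[OF cd, of f] f(1) by blast
qed

text \<open>Frankl's shadow bound. Split at the largest point \<open>x\<close> into the sets
  avoiding \<open>x\<close> and the link of \<open>x\<close>, and apply induction to both. Fewer
  than \<open>(t + 1) * k\<close> points are settled by double counting; with more there is room to
  replace \<open>x\<close> by distinct points, which makes the link cross-dependent.\<close>

lemma card_le_shadow_left_shifted:
  assumes "finite V" "F \<subseteq> nsets V k" "0 < k" "left_shifted V F" "cross_dependent {..t} (\<lambda>_. F)"
  shows "card F \<le> t * card (shadow F)"
  using assms
proof (induction "card V" arbitrary: V F k rule: less_induct)
  case (less V F k)
  note V = \<open>finite V\<close> and F = \<open>F \<subseteq> nsets V k\<close> and sh = \<open>left_shifted V F\<close>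
    and cd = \<open>cross_dependent {..t} (\<lambda>_. F)\<close>
  have finF: "finite F" using F V by (meson finite_imp_finite_nsets finite_subset)
  have finS: "finite (shadow F)"
    using shadow_subset_nsets[OF F] V by (meson finite_imp_finite_nsets finite_subset)
  consider "F = {}" | "F \<noteq> {}" "k = 1" | "card V < (t + 1) * k" | "2 \<le> k" "(t + 1) * k \<le> card V"
    using \<open>0 < k\<close> by linarith
  then show ?case
  proof cases
    case 2
    then obtain A x where "A \<in> F" "x \<in> A" using F by (fastforce simp: nsets_def card_Suc_eq)
    then have "shadow F \<noteq> {}" by (auto simp: shadow_def)
    then have "1 \<le> card (shadow F)" using finS by (simp add: Suc_leI card_gt_0_iff)
    moreover have "card F \<le> t" using card_cross_dependent_singletons[OF V _ cd] F 2 by simp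
    ultimately show ?thesis using mult_le_mono[of "card F" t 1 "card (shadow F)"] by simp
  next
    case 3
    then have "card V + 1 - k \<le> t * k" by (simp add: algebra_simps)
    then have "card F * k \<le> card (shadow F) * (t * k)"
      using card_le_shadow[OF V F \<open>0 < k\<close>] by (meson le_trans mult_le_mono2)
    then show ?thesis using \<open>0 < k\<close> by (simp add: ac_simps)
  next
    case 4
    then have "V \<noteq> {}" by auto
    define x where "x = Max V"
    have x: "x \<in> V" "\<And>y. y \<in> V \<Longrightarrow> y \<noteq> x \<Longrightarrow> y < x"
      using V \<open>V \<noteq> {}\<close> by (auto simp: x_def order.strict_iff_order)
    define V' where "V' = V - {x}"
    define F1 where "F1 = {A\<in>F. x \<notin> A}"
    define F2 where "F2 = {B\<in>nsets V' (k - 1). insert x B \<in> F}"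
    have V': "finite V'" "card V' < card V" using V x(1) card_Diff1_less[OF V x(1)]
      by (auto simp: V'_def simp del: card_Diff_insert)
    have F1: "F1 \<subseteq> nsets V' k" using F by (auto simp: F1_def V'_def nsets_def)
    have F2: "F2 \<subseteq> nsets V' (k - 1)" by (auto simp: F2_def)
    have "card F1 \<le> t * card (shadow F1)"
    proof (rule less.hyps[OF V'(2) V'(1) F1 \<open>0 < k\<close>])
      show "left_shifted V' F1"
        using sh x(1) by (auto simp: left_shifted_def F1_def V'_def)
      show "cross_dependent {..t} (\<lambda>_. F1)" using cross_dependent_mono[OF cd] by (auto simp: F1_def)
    qed
    moreover have "card F2 \<le> t * card (shadow F2)"
    proof (rule less.hyps[OF V'(2) V'(1) F2])
      show "0 < k - 1" using 4 by simp
      show "left_shifted V' F2"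
        unfolding left_shifted_def
      proof (intro ballI impI)
        fix A i j assume A: "A \<in> F2" "i \<in> V'" "j \<in> A" "i < j" "i \<notin> A"
        then have "x \<notin> A" "finite A" "card A = k - 1" "A \<subseteq> V'" by (auto simp: F2_def nsets_def V'_def)
        moreover have "insert i (insert x A - {j}) \<in> F"
          using A by (intro left_shiftedD[OF sh]) (auto simp: F2_def V'_def)
        moreover have "insert i (insert x A - {j}) = insert x (insert i (A - {j}))"
          using A \<open>x \<notin> A\<close> by auto
        moreover have "card (insert i (A - {j})) = k - 1"
          using A \<open>finite A\<close> \<open>card A = k - 1\<close> card_Suc_Diff1[of A j] by simp
        ultimately show "insert i (A - {j}) \<in> F2" using A by (auto simp: F2_def nsets_def)
      qed
      show "cross_dependent {..t} (\<lambda>_. F2)"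
        unfolding cross_dependent_def
      proof
        assume "\<exists>f. (\<forall>u\<in>{..t}. f u \<in> F2) \<and> disjoint_family_on f {..t}"
        then obtain f where f: "\<forall>u\<in>{..t}. f u \<in> F2" "disjoint_family_on f {..t}" by blast
        have fn: "f u \<subseteq> V'" "finite (f u)" "card (f u) = k - 1" "insert x (f u) \<in> F" if "u \<le> t" for u
          using f(1) that by (auto simp: F2_def nsets_def)
        \<comment> \<open>At least \<open>(t + 1) * k\<close> points minus \<open>t + 1\<close>
          disjoint sets of size \<open>k - 1\<close> leave one free point per set. Left-shiftedness
          lets it take the place of \<open>x\<close>.\<close>
        define R where "R = V - (\<Union>u\<le>t. f u)"
        have "card (\<Union>u\<le>t. f u) = (t + 1) * (k - 1)"
          using f(2) fn by (subst card_UN_disjoint) (auto simp: disjoint_family_on_def)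
        moreover have "(t + 1) * (k - 1) + (t + 1) = (t + 1) * k" using 4 by (cases k) auto
        moreover have "card R = card V - card (\<Union>u\<le>t. f u)"
          using fn(1,2) unfolding R_def V'_def by (subst card_Diff_subset) auto
        ultimately have "t + 1 \<le> card R" using 4(2) by linarith
        then obtain y where y: "y ` {..t} \<subseteq> R" "inj_on y {..t}"
          using card_le_inj[of "{..t}" R] V by (auto simp: R_def)
        have "insert (y u) (f u) \<in> F" if "u \<in> {..t}" for u
        proof (cases "y u = x")
          case False
          have yu: "y u \<in> V" "y u \<notin> f u" using y(1) that by (auto simp: R_def)
          then have "insert (y u) (insert x (f u) - {x}) \<in> F"
            using x(2)[OF yu(1) False] False fn(4) that
            by (intro left_shiftedD[OF sh]) auto
          moreover have "x \<notin> f u" using fn(1) that by (auto simp: V'_def)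
          ultimately show ?thesis by simp
        qed (use fn(4) that in auto)
        moreover have "disjoint_family_on (\<lambda>u. insert (y u) (f u)) {..t}"
          unfolding disjoint_family_on_def
        proof (intro ballI impI)
          fix u v assume uv: "u \<in> {..t}" "v \<in> {..t}" "u \<noteq> v"
          then have "y u \<noteq> y v" "f u \<inter> f v = {}" "y u \<notin> f v" "y v \<notin> f u"
            using f(2) y by (auto simp: disjoint_family_on_def R_def dest: inj_onD)
          then show "insert (y u) (f u) \<inter> insert (y v) (f v) = {}" by auto
        qed
        ultimately show False
          using cross_dependentD[OF cd, of "\<lambda>u. insert (y u) (f u)"] by blast
      qed
    qed
    moreover have "card F = card F1 + card F2"
    proof -
      have "bij_betw (insert x) F2 {A\<in>F. x \<in> A}"
      proof (rule bij_betwI[where g = "\<lambda>A. A - {x}"])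
        show "(\<lambda>A. A - {x}) \<in> {A \<in> F. x \<in> A} \<rightarrow> F2"
          using F by (auto simp: F2_def V'_def nsets_def insert_absorb)
      qed (auto simp: F2_def V'_def nsets_def)
      then have "card F2 = card {A\<in>F. x \<in> A}" by (rule bij_betw_same_card)
      moreover have "card F = card F1 + card {A\<in>F. x \<in> A}"
        unfolding F1_def using finF by (subst card_Un_disjoint[symmetric]) (auto intro: arg_cong[where f = card])
      ultimately show ?thesis by simp
    qed
    \<comment> \<open>Inside the shadow of \<open>F\<close>, the shadow of \<open>F1\<close>
      consists of sets without \<open>x\<close>, while the shadow of \<open>F2\<close> contributes
      sets with \<open>x\<close> added.\<close>
    moreover have "card (shadow F1) + card (shadow F2) \<le> card (shadow F)"
    proof -
      have x2: "x \<notin> B" if "B \<in> shadow F1 \<or> B \<in> shadow F2" for B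
        using that by (auto simp: shadow_def F1_def F2_def nsets_def V'_def)
      have "insert x B \<in> shadow F" if "B \<in> shadow F2" for B
      proof -
        obtain A y where A: "A \<in> F2" "y \<in> A" "B = A - {y}"
          using \<open>B \<in> shadow F2\<close> unfolding shadow_def by blast
        then have "x \<notin> A" "insert x A \<in> F" by (auto simp: F2_def nsets_def V'_def)
        moreover have "insert x B = insert x A - {y}" using A \<open>x \<notin> A\<close> by auto
        ultimately show ?thesis using A(2) unfolding shadow_def by blast
      qed
      moreover have "shadow F1 \<subseteq> shadow F" by (auto simp: shadow_def F1_def)
      ultimately have sub: "shadow F1 \<union> insert x ` shadow F2 \<subseteq> shadow F" by auto
      have "card (shadow F2) = card (insert x ` shadow F2)"
        using x2 by (intro card_image[symmetric] inj_onI) (metis insert_ident)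
      then have "card (shadow F1) + card (shadow F2) = card (shadow F1 \<union> insert x ` shadow F2)"
        using sub finS x2 by (subst card_Un_disjoint) (auto dest: finite_subset)
      also have "\<dots> \<le> card (shadow F)" using sub finS by (rule card_mono[rotated])
      finally show ?thesis .
    qed
    ultimately have "card F \<le> t * (card (shadow F1) + card (shadow F2))"
      by (simp add: algebra_simps)
    then show ?thesis using \<open>card (shadow F1) + card (shadow F2) \<le> card (shadow F)\<close>
      by (meson le_trans mult_le_mono2)
  qed simp
qed

section \<open>Links and traces on a fixed set\<close>

definition link :: "'a set \<Rightarrow> 'a \<Rightarrow> 'a set set \<Rightarrow> 'a set set" where
  "link U u F = {B. B \<inter> U = {} \<and> insert u B \<in> F}"

lemma card_link:
  assumes "u \<in> U"
  shows "card (link U u F) = card {A\<in>F. A \<inter> U = {u}}"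
proof -
  have "bij_betw (insert u) (link U u F) {A\<in>F. A \<inter> U = {u}}"
  proof (rule bij_betwI[where g = "\<lambda>A. A - {u}"])
    show "(\<lambda>A. A - {u}) \<in> {A \<in> F. A \<inter> U = {u}} \<rightarrow> link U u F"
      by (auto simp: link_def) (metis insert_absorb singletonI Int_iff)
  qed (use assms in \<open>auto simp: link_def\<close>)
  then show ?thesis by (rule bij_betw_same_card)
qed

lemma link_nsets:
  assumes "u \<in> U" "U \<subseteq> V" "0 < k"
  shows "link U u (nsets V k) = nsets (V - U) (k - 1)"
proof (intro set_eqI)
  fix B
  show "B \<in> link U u (nsets V k) \<longleftrightarrow> B \<in> nsets (V - U) (k - 1)"
  proof (cases "finite B \<and> B \<inter> U = {}")
    case True
    moreover from this have "u \<notin> B" using assms(1) by auto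
    ultimately have "card (insert u B) = Suc (card B)" by simp
    then show ?thesis using True assms by (auto simp: link_def nsets_def)
  qed (auto simp: link_def nsets_def)
qed

lemma link_mono: "F \<subseteq> G \<Longrightarrow> link U u F \<subseteq> link U u G"
  by (auto simp: link_def)

lemma cross_dependent_link:
  assumes "cross_dependent U (\<lambda>_. F)"
  shows "cross_dependent U (\<lambda>u. link U u F)"
  unfolding cross_dependent_def
proof
  assume "\<exists>f. (\<forall>u\<in>U. f u \<in> link U u F) \<and> disjoint_family_on f U"
  then obtain f where f: "\<forall>u\<in>U. f u \<in> link U u F" "disjoint_family_on f U" by blast
  have "disjoint_family_on (\<lambda>u. insert u (f u)) U"
    using f by (fastforce simp: disjoint_family_on_def link_def)
  then show False using cross_dependentD[OF assms, of "\<lambda>u. insert u (f u)"] f(1)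
    by (auto simp: link_def)
qed

lemma card_trace_split:
  assumes "finite F" "finite U"
  shows "card F = card {A\<in>F. A \<inter> U = {}} + (\<Sum>u\<in>U. card (link U u F)) + card {A\<in>F. 2 \<le> card (A \<inter> U)}"
proof -
  have "(\<Sum>u\<in>U. card (link U u F)) = (\<Sum>u\<in>U. card {A\<in>F. A \<inter> U = {u}})"
    by (intro sum.cong refl card_link)
  also have "\<dots> = card (\<Union>u\<in>U. {A\<in>F. A \<inter> U = {u}})"
    using assms by (intro card_UN_disjoint[symmetric]) auto
  also have "(\<Union>u\<in>U. {A\<in>F. A \<inter> U = {u}}) = {A\<in>F. card (A \<inter> U) = 1}"
    by (auto simp: card_1_singleton_iff)
  finally have *: "(\<Sum>u\<in>U. card (link U u F)) = card {A\<in>F. card (A \<inter> U) = 1}" .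
  have cover: "F = ({A\<in>F. A \<inter> U = {}} \<union> {A\<in>F. card (A \<inter> U) = 1}) \<union> {A\<in>F. 2 \<le> card (A \<inter> U)}"
  proof (intro equalityI subsetI)
    fix A assume "A \<in> F"
    moreover have "A \<inter> U = {} \<or> card (A \<inter> U) = 1 \<or> 2 \<le> card (A \<inter> U)"
    proof -
      have "card (A \<inter> U) = 0 \<or> card (A \<inter> U) = 1 \<or> 2 \<le> card (A \<inter> U)" by linarith
      then show ?thesis using assms(2) card_0_eq[of "A \<inter> U"] by simp
    qed
    ultimately show "A \<in> ({A\<in>F. A \<inter> U = {}} \<union> {A\<in>F. card (A \<inter> U) = 1}) \<union> {A\<in>F. 2 \<le> card (A \<inter> U)}"
      by blast
  qed auto
  have "card (({A\<in>F. A \<inter> U = {}} \<union> {A\<in>F. card (A \<inter> U) = 1}) \<union> {A\<in>F. 2 \<le> card (A \<inter> U)})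
      = card {A\<in>F. A \<inter> U = {}} + card {A\<in>F. card (A \<inter> U) = 1} + card {A\<in>F. 2 \<le> card (A \<inter> U)}"
  proof (subst card_Un_disjoint)
    show "({A\<in>F. A \<inter> U = {}} \<union> {A\<in>F. card (A \<inter> U) = 1}) \<inter> {A\<in>F. 2 \<le> card (A \<inter> U)} = {}"
      by auto
    have "card ({A\<in>F. A \<inter> U = {}} \<union> {A\<in>F. card (A \<inter> U) = 1})
        = card {A\<in>F. A \<inter> U = {}} + card {A\<in>F. card (A \<inter> U) = 1}"
      using assms(1) by (intro card_Un_disjoint) auto
    then show "card ({A\<in>F. A \<inter> U = {}} \<union> {A\<in>F. card (A \<inter> U) = 1}) + card {A\<in>F. 2 \<le> card (A \<inter> U)} =
        card {A\<in>F. A \<inter> U = {}} + card {A\<in>F. card (A \<inter> U) = 1} + card {A\<in>F. 2 \<le> card (A \<inter> U)}"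
      by simp
  qed (use assms(1) in auto)
  then show ?thesis unfolding * using arg_cong[OF cover, of card] by linarith
qed

lemma card_nsets_meeting:
  assumes "finite V" "T \<subseteq> V"
  shows "card {A\<in>nsets V k. A \<inter> T \<noteq> {}} = (card V choose k) - ((card V - card T) choose k)"
proof -
  have "{A\<in>nsets V k. A \<inter> T \<noteq> {}} = nsets V k - nsets (V - T) k" by (auto simp: nsets_def)
  moreover have "nsets (V - T) k \<subseteq> nsets V k" by (auto simp: nsets_def)
  ultimately show ?thesis using assms finite_subset[OF assms(2,1)]
    by (simp add: card_Diff_subset finite_imp_finite_nsets card_nsets)
qed

text \<open>The right side counts the \<open>k\<close>-sets meeting \<open>T\<close>, which is
  \<open>U\<close> without one point. Two points in \<open>U\<close> force a point in
  \<open>T\<close>, and each of the \<open>t\<close> points of \<open>T\<close> is the whole trace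
  on \<open>U\<close> of \<open>(card V - Suc t) choose (k - 1)\<close> further sets.\<close>

lemma card_nsets_meeting_ge:
  assumes V: "finite V" and U: "U \<subseteq> V" "card U = Suc t" and k: "0 < k"
  shows "card {A\<in>nsets V k. 2 \<le> card (A \<inter> U)} + t * ((card V - Suc t) choose (k - 1))
    \<le> (card V choose k) - ((card V - t) choose k)"
proof -
  have fU: "finite U" using U V finite_subset by blast
  obtain j where j: "j \<in> U" using U by fastforce
  define T where "T = U - {j}"
  have T: "T \<subseteq> V" "card T = t" "finite T" using U j fU by (auto simp: T_def)
  define F where "F = {A\<in>nsets V k. A \<inter> T \<noteq> {}}"
  have finF: "finite F" using V by (simp add: F_def finite_imp_finite_nsets)
  have "link U u F = nsets (V - U) (k - 1)" if "u \<in> T" for u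
  proof -
    have "link U u F = link U u (nsets V k)" using that by (auto simp: link_def F_def)
    then show ?thesis using that U k by (simp add: link_nsets T_def)
  qed
  then have "t * ((card V - Suc t) choose (k - 1)) = (\<Sum>u\<in>T. card (link U u F))"
    using T V U fU by (simp add: card_nsets card_Diff_subset)
  also have "\<dots> \<le> (\<Sum>u\<in>U. card (link U u F))" using fU by (intro sum_mono2) (auto simp: T_def)
  finally have "t * ((card V - Suc t) choose (k - 1)) \<le> (\<Sum>u\<in>U. card (link U u F))" .
  moreover have eq: "{A\<in>nsets V k. 2 \<le> card (A \<inter> U)} = {A\<in>F. 2 \<le> card (A \<inter> U)}"
  proof -
    have "A \<inter> T \<noteq> {}" if "2 \<le> card (A \<inter> U)" for A
    proof
      assume "A \<inter> T = {}"
      then have "A \<inter> U \<subseteq> {j}" by (auto simp: T_def)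
      then have "card (A \<inter> U) \<le> card {j}" by (intro card_mono) auto
      then show False using that by simp
    qed
    then show ?thesis by (auto simp: F_def)
  qed
  ultimately have "card {A\<in>nsets V k. 2 \<le> card (A \<inter> U)} + t * ((card V - Suc t) choose (k - 1)) \<le> card F"
    using card_trace_split[OF finF fU] unfolding eq by linarith
  then show ?thesis using card_nsets_meeting[OF V T(1)] T(2) by (simp add: F_def)
qed

text \<open>Traces of size two or more are bounded by all \<open>k\<close>-sets with such traces.
  Hence a deficit against \<open>t\<close> full links among the smaller traces is a deficit against
  the sets meeting a fixed \<open>t\<close>-set.\<close>

lemma deficit_from_traces:
  assumes V: "finite V" and U: "U \<subseteq> V" "card U = Suc t" and k: "0 < k" and F: "F \<subseteq> nsets V k"
    and le: "c * (card {A\<in>F. A \<inter> U = {}} + (\<Sum>u\<in>U. card (link U u F))) + D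
      \<le> c * (t * ((card V - Suc t) choose (k - 1)))"
  shows "c * card F + D \<le> c * ((card V choose k) - ((card V - t) choose k))"
proof -
  have fU: "finite U" using U V finite_subset by blast
  have fin: "finite (nsets V k)" using V by (simp add: finite_imp_finite_nsets)
  have finF: "finite F" using F fin finite_subset by blast
  let ?R = "card {A\<in>nsets V k. 2 \<le> card (A \<inter> U)}"
  have "card {A\<in>F. 2 \<le> card (A \<inter> U)} \<le> ?R" using F fin by (intro card_mono) auto
  then have "card F \<le> card {A\<in>F. A \<inter> U = {}} + (\<Sum>u\<in>U. card (link U u F)) + ?R"
    using card_trace_split[OF finF fU] by linarith
  then have "c * card F \<le> c * (card {A\<in>F. A \<inter> U = {}} + (\<Sum>u\<in>U. card (link U u F)) + ?R)"
    by (rule mult_le_mono2)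
  then have "c * card F + D \<le> c * (?R + t * ((card V - Suc t) choose (k - 1)))"
    using le unfolding add_mult_distrib2 by linarith
  also have "\<dots> \<le> c * ((card V choose k) - ((card V - t) choose k))"
    using card_nsets_meeting_ge[OF V U k] by (rule mult_le_mono2)
  finally show ?thesis .
qed

section \<open>Stability for families without a small cover\<close>

text \<open>For \<open>U\<close> the first \<open>t + 1\<close> points, left-shiftedness orders the
  links into a chain and puts the shadow of the sets missing \<open>U\<close> into the smallest link
  \<open>H 0\<close>. The shadow bound charges those sets \<open>t\<close> times to
  \<open>H 0\<close>, whence its weight \<open>t + 1\<close> in
  \<open>chain_sum_deficit\<close>.\<close>

lemma uncovered_left_shifted_deficit:
  assumes F: "F \<subseteq> nsets {1..n} k" and sh: "left_shifted {1..n} F"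
    and cd: "cross_dependent {..t} (\<lambda>_. F)" and t: "0 < t" and k: "2 \<le> k"
    and n: "(2 * t + 2) * (k - 1) + Suc t \<le> n"
    and unc: "\<And>T. T \<in> nsets {1..n} t \<Longrightarrow> \<exists>A\<in>F. A \<inter> T = {}"
  shows "(t + 2) * card F + ((n - Suc t - (k - 1)) choose (k - 1))
    \<le> (t + 2) * ((n choose k) - ((n - t) choose k))"
proof -
  define U where "U = {1..Suc t}"
  define W where "W = {1..n} - U"
  have U: "U \<subseteq> {1..n}" "card U = Suc t" "finite U" using n by (auto simp: U_def)
  have cW: "card W = n - Suc t" using U by (simp add: W_def card_Diff_subset)
  have finN: "finite (nsets {1..n} j)" for j by (simp add: finite_imp_finite_nsets)
  have finF: "finite F" using F finN finite_subset by blast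
  \<comment> \<open>Smaller points have larger links, so the reversed numbering makes
    \<open>H\<close> increasing.\<close>
  define H where "H i = link U (Suc t - i) F" for i
  have H: "H i \<subseteq> nsets W (k - 1)" if "i \<le> t" for i
    using link_mono[OF F, of U "Suc t - i"] link_nsets[of "Suc t - i" U "{1..n}" k] U that k
    by (auto simp: H_def W_def U_def)
  have finW: "finite (nsets W j)" for j by (simp add: finite_imp_finite_nsets W_def)
  have cdU: "cross_dependent U (\<lambda>_. F)"
    by (rule cross_dependent_reindex[OF _ cd, of "\<lambda>u. u - 1"])
      (rule bij_betwI[where g = Suc], auto simp: U_def)
  have refl_bij: "bij_betw (\<lambda>i. Suc t - i) {..t} U"
    by (rule bij_betwI[where g = "\<lambda>i. Suc t - i"]) (auto simp: U_def)
  have cdH: "cross_dependent {..t} H"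
    using cross_dependent_reindex[OF refl_bij cross_dependent_link[OF cdU]] by (simp add: H_def[abs_def])
  have chain: "H i \<subseteq> H j" if "i \<le> j" "j \<le> t" for i j
  proof (cases "i = j")
    case False
    then have ij: "i < j" using that by simp
    show ?thesis
    proof
      fix B assume "B \<in> H i"
      then have B: "B \<inter> U = {}" "insert (Suc t - i) B \<in> F" by (auto simp: H_def link_def)
      have mem: "Suc t - i \<in> U" "Suc t - j \<in> U" using that by (auto simp: U_def)
      have "insert (Suc t - j) (insert (Suc t - i) B - {Suc t - i}) \<in> F"
        using B mem U(1) ij that by (intro left_shiftedD[OF sh]) auto
      moreover have "insert (Suc t - i) B - {Suc t - i} = B" using B(1) mem by auto
      ultimately show "B \<in> H j" using B(1) by (simp add: H_def link_def)
    qed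
  qed simp
  have into_H0: "A - {x} \<in> H 0" if A: "A \<in> F" "A \<inter> U = {}" "x \<in> A" for A x
  proof -
    have "x \<in> {1..n}" using A F unfolding nsets_def by blast
    then have "insert (Suc t) (A - {x}) \<in> F"
      using A U(1) by (intro left_shiftedD[OF sh]) (auto simp: U_def)
    then show ?thesis using A(2) by (auto simp: H_def link_def)
  qed
  \<comment> \<open>A member missing \<open>{1..t}\<close> either contains \<open>Suc t\<close> or
    can be shifted onto it.\<close>
  have "H 0 \<noteq> {}"
  proof -
    have "{1..t} \<in> nsets {1..n} t" using n by (auto simp: nsets_def)
    then obtain A where A: "A \<in> F" "A \<inter> {1..t} = {}" using unc by blast
    show ?thesis
    proof (cases "Suc t \<in> A")
      case True
      then have "A - {Suc t} \<in> H 0" using A by (auto simp: H_def link_def U_def insert_absorb)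
      then show ?thesis by auto
    next
      case False
      then have "A \<inter> U = {}" using A(2) by (auto simp: U_def atLeastAtMostSuc_conv)
      moreover have "A \<noteq> {}" using A(1) F k by (auto simp: nsets_def)
      ultimately show ?thesis using into_H0[OF A(1)] by blast
    qed
  qed
  define F0 where "F0 = {A\<in>F. A \<inter> U = {}}"
  have F0: "F0 \<subseteq> nsets W k" using F by (auto simp: F0_def W_def nsets_def)
  have "card F0 \<le> t * card (shadow F0)"
  proof (rule card_le_shadow_left_shifted[OF _ F0])
    show "left_shifted W F0"
      using sh unfolding left_shifted_def F0_def W_def by auto
    show "cross_dependent {..t} (\<lambda>_. F0)" using cross_dependent_mono[OF cd] by (auto simp: F0_def)
  qed (use k in \<open>auto simp: W_def\<close>)
  also have "\<dots> \<le> t * card (H 0)"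
  proof (intro mult_le_mono2 card_mono)
    show "finite (H 0)" using H[of 0] finW finite_subset by blast
    show "shadow F0 \<subseteq> H 0" using into_H0 by (auto simp: shadow_def F0_def)
  qed
  finally have F0_le: "card F0 \<le> t * card (H 0)" .
  have "(\<Sum>u\<in>U. card (link U u F)) = (\<Sum>i\<le>t. card (H i))"
    unfolding H_def by (rule sum.reindex_bij_betw[OF refl_bij, symmetric])
  also have "{..t} = insert 0 {1..t}" by auto
  finally have "card F0 + (\<Sum>u\<in>U. card (link U u F)) \<le> (\<Sum>i=1..t. card (H i)) + (t + 1) * card (H 0)"
    using F0_le by simp
  then have "(t + 2) * (card F0 + (\<Sum>u\<in>U. card (link U u F)))
      \<le> (t + 2) * ((\<Sum>i=1..t. card (H i)) + (t + 1) * card (H 0))" by (rule mult_le_mono2)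
  moreover have "(t + 2) * ((\<Sum>i=1..t. card (H i)) + (t + 1) * card (H 0))
      + ((card W - (k - 1)) choose (k - 1)) \<le> (t + 2) * (t * (card W choose (k - 1)))"
  proof (rule chain_sum_deficit[OF _ _ t H chain cdH \<open>H 0 \<noteq> {}\<close>])
    show "(2 * t + 2) * (k - 1) \<le> card W" using n by (simp add: cW)
  qed (simp_all add: W_def)
  ultimately have "(t + 2) * (card F0 + (\<Sum>u\<in>U. card (link U u F))) + ((n - Suc t - (k - 1)) choose (k - 1))
      \<le> (t + 2) * (t * ((n - Suc t) choose (k - 1)))" unfolding cW by linarith
  then show ?thesis
    using deficit_from_traces[OF _ U(1,2) _ F, of "t + 2"] k by (simp add: F0_def)
qed

text \<open>Shift until the family is left-shifted or the next shift would create a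
  \<open>t\<close>-cover \<open>T\<close>. In the latter case \<open>insert j T\<close> covers the
  family before that shift, so no member has empty trace on it and the links at its points carry the
  bound.\<close>

lemma uncovered_deficit:
  assumes "F \<subseteq> nsets {1..n} k" and "cross_dependent {..t} (\<lambda>_. F)" and t: "0 < t" and k: "2 \<le> k"
    and n: "(2 * t + 2) * (k - 1) + Suc t \<le> n"
    and "\<And>T. T \<in> nsets {1..n} t \<Longrightarrow> \<exists>A\<in>F. A \<inter> T = {}"
  shows "(t + 2) * card F + ((n - Suc t - (k - 1)) choose (k - 1))
    \<le> (t + 2) * ((n choose k) - ((n - t) choose k))"
  using assms(1,2,6)
proof (induction "\<Sum>A\<in>F. \<Sum>A" arbitrary: F rule: less_induct)
  case (less F)
  note F = \<open>F \<subseteq> nsets {1..n} k\<close> and cd = \<open>cross_dependent {..t} (\<lambda>_. F)\<close> and unc = less.prems(3)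
  show ?case
  proof (cases "left_shifted {1..n} F")
    case True
    then show ?thesis using uncovered_left_shifted_deficit[OF F True cd t k n unc] by simp
  next
    case False
    then obtain A i j where ij: "i \<in> {1..n}" "i < j"
      and A: "A \<in> F" "j \<in> A" "i \<notin> A" "insert i (A - {j}) \<notin> F"
      unfolding left_shifted_def by blast
    have j: "j \<in> {1..n}" using A F unfolding nsets_def by blast
    define F' where "F' = shift i j F"
    show ?thesis
    proof (cases "\<exists>T\<in>nsets {1..n} t. \<forall>A\<in>F'. A \<inter> T \<noteq> {}")
      case False
      have "(t + 2) * card F' + ((n - Suc t - (k - 1)) choose (k - 1))
        \<le> (t + 2) * ((n choose k) - ((n - t) choose k))"
      proof (rule less.hyps)
        show "(\<Sum>A\<in>F'. \<Sum>A) < (\<Sum>A\<in>F. \<Sum>A)"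
          unfolding F'_def by (rule weight_shift_less[OF ij(2) F _ A]) simp
        show "F' \<subseteq> nsets {1..n} k" unfolding F'_def by (rule shift_subset_nsets[OF F ij(1)])
        show "cross_dependent {..t} (\<lambda>_. F')"
          unfolding F'_def using cd ij(2) by (intro cross_dependent_shift) auto
        show "\<exists>A\<in>F'. A \<inter> T = {}" if "T \<in> nsets {1..n} t" for T using False that by blast
      qed
      then show ?thesis by (simp add: F'_def card_shift)
    next
      case True
      then obtain T where T: "T \<in> nsets {1..n} t" "\<And>A. A \<in> F' \<Longrightarrow> A \<inter> T \<noteq> {}" by blast
      \<comment> \<open>The sets of \<open>F\<close> missing \<open>T\<close> are moved by the shift, hence contain \<open>j\<close>.\<close>
      have miss: "j \<in> B" if "B \<in> F" "B \<inter> T = {}" for B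
      proof -
        have "shift_set i j F B \<in> F'" using that by (simp add: F'_def shift_def)
        then have "shift_set i j F B \<noteq> B" using T(2) that(2) by metis
        then show ?thesis by (auto simp: shift_set_def split: if_splits)
      qed
      define U where "U = insert j T"
      define W where "W = {1..n} - U"
      obtain A0 where "A0 \<in> F" "A0 \<inter> T = {}" using unc[OF T(1)] by blast
      then have "j \<notin> T" using miss by blast
      then have U: "U \<subseteq> {1..n}" "card U = Suc t" "finite U"
        using T(1) j by (auto simp: U_def nsets_def)
      have cW: "card W = n - Suc t" using U by (simp add: W_def card_Diff_subset)
      have cover: "B \<inter> U \<noteq> {}" if "B \<in> F" for B using miss[OF that] by (auto simp: U_def)
      obtain h where h: "bij_betw h U {..t}"
        using finite_same_card_bij[of U "{..t}"] U by auto
      have cdU: "cross_dependent U (\<lambda>_. F)" using cross_dependent_reindex[OF h cd] by simp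
      have "(t + 2) * (\<Sum>u\<in>U. card (link U u F)) + ((card W - (k - 1)) choose (k - 1))
          \<le> (t + 2) * (t * (card W choose (k - 1)))"
      proof (rule cross_dependent_sum_deficit[OF _ _ t U(3,2)])
        show "cross_dependent U (\<lambda>u. link U u F)" by (rule cross_dependent_link[OF cdU])
        show "link U u F \<subseteq> nsets W (k - 1)" if "u \<in> U" for u
          using link_mono[OF F, of U u] link_nsets[OF that U(1), of k] k by (simp add: W_def)
        \<comment> \<open>Since \<open>U - {u}\<close> is too small to be a cover, some member meets
          \<open>U\<close> in \<open>u\<close> only.\<close>
        show "link U u F \<noteq> {}" if u: "u \<in> U" for u
        proof -
          have "U - {u} \<in> nsets {1..n} t" using U u by (auto simp: nsets_def)
          then obtain B where B: "B \<in> F" "B \<inter> (U - {u}) = {}" using unc by blast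
          then have "B \<inter> U = {u}" using cover[OF B(1)] by blast
          moreover from this have "insert u (B - {u}) = B" by auto
          ultimately have "B - {u} \<in> link U u F" using B(1) by (auto simp: link_def)
          then show ?thesis by blast
        qed
        show "(2 * t + 2) * (k - 1) \<le> card W" using n by (simp add: cW)
      qed (auto simp: W_def)
      moreover have "{A\<in>F. A \<inter> U = {}} = {}" using cover by blast
      then have "card {A\<in>F. A \<inter> U = {}} = 0" by (simp only: card.empty)
      ultimately show ?thesis
        using deficit_from_traces[OF _ U(1,2) _ F, of "t + 2"] k by (simp add: cW)
    qed
  qed
qed

section \<open>Set pairs\<close>

text \<open>Induction by deleting a point \<open>x\<close>: keep the pairs with \<open>x\<close>
  outside \<open>A i\<close> and remove \<open>x\<close> from \<open>B i\<close>. The intersections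
  survive because they lie in kept sets \<open>A i\<close>. Averaging over all \<open>x\<close>
  returns the original sum.\<close>

lemma Bollobas_set_pairs_sum:
  assumes "finite X" "finite I"
    and "\<And>i. i \<in> I \<Longrightarrow> A i \<subseteq> X" "\<And>i. i \<in> I \<Longrightarrow> B i \<subseteq> X"
    and "\<And>i. i \<in> I \<Longrightarrow> A i \<inter> B i = {}"
    and "\<And>i j. i \<in> I \<Longrightarrow> j \<in> I \<Longrightarrow> i \<noteq> j \<Longrightarrow> A i \<inter> B j \<noteq> {}"
  shows "(\<Sum>i\<in>I. 1 / real ((card (A i) + card (B i)) choose card (A i))) \<le> 1"
  using assms
proof (induction "card X" arbitrary: X I B rule: less_induct)
  case (less X I B)
  have fin: "finite (A i)" "finite (B i)" if "i \<in> I" for i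
    using less.prems(1,3,4) that finite_subset by metis+
  show ?case
  proof (cases "\<exists>i\<in>I. B i = {}")
    case True
    then obtain i where i: "i \<in> I" "B i = {}" by blast
    \<comment> \<open>An empty \<open>B i\<close> meets no \<open>A j\<close>, so there is no second
      index.\<close>
    then have "I = {i}" using less.prems(6) by blast
    then show ?thesis using i by simp
  next
    case False
    show ?thesis
    proof (cases "X = {}")
      case True
      then have "I = {}" using False less.prems(4) by blast
      then show ?thesis by simp
    next
      case Xne: False
      define w where "w a b = 1 / real ((a + b) choose a)" for a b
      have sub: "(\<Sum>i | i \<in> I \<and> x \<notin> A i. w (card (A i)) (card (B i - {x}))) \<le> 1" if x: "x \<in> X" for x
        unfolding w_def
      proof (rule less.hyps)
        show "card (X - {x}) < card X" using less.prems(1) x by (rule card_Diff1_less)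
        show "A i \<inter> (B j - {x}) \<noteq> {}"
          if "i \<in> {i. i \<in> I \<and> x \<notin> A i}" "j \<in> {i. i \<in> I \<and> x \<notin> A i}" "i \<noteq> j" for i j
          using less.prems(6)[of i j] that by blast
        show "A i \<subseteq> X - {x}" "B i - {x} \<subseteq> X - {x}" "A i \<inter> (B i - {x}) = {}"
          if "i \<in> {i. i \<in> I \<and> x \<notin> A i}" for i
          using less.prems(3-5)[of i] that by blast+
      qed (use less.prems(1,2) in auto)
      have per: "(\<Sum>x | x \<in> X \<and> x \<notin> A i. w (card (A i)) (card (B i - {x}))) = card X * w (card (A i)) (card (B i))"
        if i: "i \<in> I" for i
      proof -
        let ?a = "card (A i)" and ?b = "card (B i)"
        have b: "0 < ?b" using False fin(2)[OF i] i by (simp add: card_gt_0_iff)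
        have AB: "A i \<subseteq> X" "B i \<subseteq> X" "A i \<inter> B i = {}" using less.prems i by auto
        have X: "{x. x \<in> X \<and> x \<notin> A i} = B i \<union> (X - A i - B i)" using AB by auto
        have c1: "real (card (X - A i - B i)) = real (card X) - ?a - ?b"
        proof -
          have "X - A i - B i = X - (A i \<union> B i)" by blast
          then have "card (X - A i - B i) = card X - card (A i \<union> B i)"
            using AB(1,2) fin[OF i] by (simp only:) (intro card_Diff_subset, auto)
          moreover have "card (A i \<union> B i) = ?a + ?b" using AB fin[OF i] by (simp add: card_Un_disjoint)
          moreover have "card (A i \<union> B i) \<le> card X" using AB less.prems(1) by (intro card_mono) auto
          ultimately show ?thesis by simp
        qed
        \<comment> \<open>Removing a point of \<open>B i\<close> multiplies the weight by
          \<open>(a + b) / b\<close>, where \<open>a\<close> and \<open>b\<close> are the two sizes.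
          Over the \<open>b\<close> points of \<open>B i\<close> this makes up for the
          \<open>a\<close> points of \<open>A i\<close> that are left out.\<close>
        have w1: "?b * w ?a (?b - 1) = (?a + ?b) * w ?a ?b"
        proof -
          obtain b' where b': "?b = Suc b'" using b gr0_implies_Suc by blast
          have "Suc b' * (Suc (?a + b') choose Suc b') = Suc (?a + b') * ((?a + b') choose b')"
            by (rule Suc_times_binomial)
          moreover have "(Suc (?a + b') choose Suc b') = ((?a + Suc b') choose ?a)"
            using binomial_symmetric[of ?a "?a + Suc b'"] by simp
          moreover have "((?a + b') choose b') = ((?a + b') choose ?a)"
            using binomial_symmetric[of ?a "?a + b'"] by simp
          ultimately have *: "Suc b' * ((?a + Suc b') choose ?a) = Suc (?a + b') * ((?a + b') choose ?a)"
            by simp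
          have "real (Suc b') * real ((?a + Suc b') choose ?a) = real (Suc (?a + b')) * real ((?a + b') choose ?a)"
            using arg_cong[OF *, of real] by (simp only: of_nat_mult)
          then show ?thesis unfolding w_def b' by (simp add: field_simps del: of_nat_Suc binomial_Suc_Suc)
        qed
        have "(\<Sum>x | x \<in> X \<and> x \<notin> A i. w ?a (card (B i - {x}))) =
            (\<Sum>x\<in>B i. w ?a (card (B i - {x}))) + (\<Sum>x\<in>X - A i - B i. w ?a (card (B i - {x})))"
          unfolding X using fin[OF i] less.prems(1) by (intro sum.union_disjoint) auto
        also have "(\<Sum>x\<in>B i. w ?a (card (B i - {x}))) = ?b * w ?a (?b - 1)"
          using fin(2)[OF i] by simp
        also have "(\<Sum>x\<in>X - A i - B i. w ?a (card (B i - {x}))) = (\<Sum>x\<in>X - A i - B i. w ?a ?b)"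
          by (intro sum.cong refl) simp
        finally show ?thesis by (simp only: w1 c1 sum_constant) (simp add: algebra_simps)
      qed
      have "card X * (\<Sum>i\<in>I. w (card (A i)) (card (B i)))
          = (\<Sum>i\<in>I. \<Sum>x | x \<in> X \<and> x \<notin> A i. w (card (A i)) (card (B i - {x})))"
        unfolding sum_distrib_left using per by (intro sum.cong) auto
      also have "\<dots> = (\<Sum>x\<in>X. \<Sum>i | i \<in> I \<and> x \<notin> A i. w (card (A i)) (card (B i - {x})))"
        by (rule sum.swap_restrict[OF less.prems(2,1)])
      also have "\<dots> \<le> (\<Sum>x\<in>X. 1)" using sub by (rule sum_mono)
      finally have "card X * (\<Sum>i\<in>I. w (card (A i)) (card (B i))) \<le> real (card X) * 1" by simp
      moreover have "0 < real (card X)" using Xne less.prems(1) by (simp add: card_gt_0_iff)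
      ultimately show ?thesis unfolding w_def by (simp only: mult_le_cancel_left_pos)
    qed
  qed
qed

lemma Bollobas_set_pairs:
  assumes "finite X" "finite I"
    and "\<And>i. i \<in> I \<Longrightarrow> A i \<in> nsets X a" "\<And>i. i \<in> I \<Longrightarrow> B i \<in> nsets X b"
    and "\<And>i. i \<in> I \<Longrightarrow> A i \<inter> B i = {}"
    and "\<And>i j. i \<in> I \<Longrightarrow> j \<in> I \<Longrightarrow> i \<noteq> j \<Longrightarrow> A i \<inter> B j \<noteq> {}"
  shows "card I \<le> (a + b) choose a"
proof -
  have "(\<Sum>i\<in>I. 1 / real ((card (A i) + card (B i)) choose card (A i))) \<le> 1"
    using assms by (intro Bollobas_set_pairs_sum[of X]) (auto simp: nsets_def)
  moreover have "(\<Sum>i\<in>I. 1 / real ((card (A i) + card (B i)) choose card (A i)))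
      = (\<Sum>i\<in>I. 1 / real ((a + b) choose a))"
    using assms(3,4) by (intro sum.cong refl) (auto simp: nsets_def)
  ultimately have "real (card I) / real ((a + b) choose a) \<le> 1" by simp
  moreover have "0 < (a + b) choose a" by simp
  ultimately show ?thesis by (simp add: divide_le_eq split: if_splits)
qed

section \<open>Binomial estimates\<close>

text \<open>The quotient of the two binomials is a product of factors
  \<open>(b - i) / (a - i)\<close>, each at most \<open>b / a\<close>.\<close>

lemma power_times_binomial_le:
  fixes a b :: nat
  assumes "b \<le> a"
  shows "a ^ l * (b choose l) \<le> b ^ l * (a choose l)"
proof (induction l)
  case (Suc l)
  have step: "Suc l * (x choose Suc l) = (x - l) * (x choose l)" for x :: nat
    by (simp only: binomial_absorption binomial_absorb_comp)
  have "a * (b - l) \<le> b * (a - l)"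
    using assms by (simp add: diff_mult_distrib2 mult.commute[of a b] diff_le_mono2)
  then have "(a * (b - l)) * (a ^ l * (b choose l)) \<le> (b * (a - l)) * (b ^ l * (a choose l))"
    using Suc by (rule mult_le_mono)
  then have "a ^ Suc l * ((b - l) * (b choose l)) \<le> b ^ Suc l * ((a - l) * (a choose l))"
    by (simp add: ac_simps)
  then have "Suc l * (a ^ Suc l * (b choose Suc l)) \<le> Suc l * (b ^ Suc l * (a choose Suc l))"
    unfolding step[symmetric] by (simp only: ac_simps)
  then show ?case by (simp only: mult_le_cancel1)
qed simp

text \<open>The left side is the term of the binomial expansion that is linear in
  \<open>q\<close>.\<close>

lemma power_add_ge:
  fixes x q :: real
  assumes "0 \<le> x" "0 \<le> q"
  shows "real (Suc m) * x ^ m * q \<le> (x + q) ^ Suc m"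
proof (induction m)
  case (Suc m)
  have "real (Suc (Suc m)) * x ^ Suc m * q = x * (real (Suc m) * x ^ m * q) + q * x ^ Suc m"
    by (simp add: algebra_simps)
  also have "\<dots> \<le> x * (x + q) ^ Suc m + q * (x + q) ^ Suc m"
    using assms Suc by (intro add_mono mult_left_mono power_mono) auto
  finally show ?case by (simp add: algebra_simps)
qed (use assms in simp)

text \<open>For \<open>k = m + 3\<close> the linear term of \<open>power_add_ge\<close>, with
  \<open>(3 / 2) ^ m\<close> bounded by Bernoulli, has order \<open>k ^ 2 * q\<close>, that is
  \<open>s ^ 3 * k\<close>.\<close>

lemma power_bound:
  fixes s :: real
  assumes "3 \<le> k" "0 < s"
  shows "4 * s ^ 3 * real k \<le> (3 / 2 + 37 * s ^ 3 / real k) ^ (k - 2)"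
proof -
  obtain m where k: "k = m + 3" using assms by (metis le_add_diff_inverse2)
  define q where "q = 37 * s ^ 3 / real k"
  have q: "0 \<le> q" using assms by (simp add: q_def)
  have "1 + real m * (1 / 2) \<le> (1 + 1 / 2 :: real) ^ m" by (rule Bernoulli_inequality) simp
  then have "real (Suc m) * (1 + real m / 2) * q \<le> real (Suc m) * (3 / 2) ^ m * q"
    using q by (intro mult_right_mono mult_left_mono) auto
  also have "\<dots> \<le> (3 / 2 + q) ^ Suc m" using q by (intro power_add_ge) auto
  finally have "real (Suc m) * (1 + real m / 2) * q \<le> (3 / 2 + q) ^ (k - 2)"
    by (simp add: k numeral_eq_Suc)
  moreover have "4 * s ^ 3 * real k \<le> real (Suc m) * (1 + real m / 2) * q"
  proof -
    \<comment> \<open>The tightest case is \<open>m = 0\<close>, where it reads 72 <= 74; this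
      accounts for the constant 37.\<close>
    have "8 * (real m + 3)\<^sup>2 \<le> 37 * ((real m + 1) * (real m + 2))"
      by (simp add: power2_eq_square algebra_simps)
    then have "s ^ 3 * (8 * (real m + 3)\<^sup>2) \<le> s ^ 3 * (37 * ((real m + 1) * (real m + 2)))"
      using assms by (intro mult_left_mono) auto
    then show ?thesis
      by (simp add: q_def k field_simps power2_eq_square)
  qed
  ultimately show ?thesis unfolding q_def by linarith
qed

text \<open>The left side is twice the exponent in the count of maximal families, times the factor
  \<open>s + 1\<close> of the stability bound. With \<open>R = a / (s * k)\<close> the binomials
  have quotient at least \<open>R ^ (k - 1) / s\<close>; one factor \<open>R\<close> absorbs
  \<open>n + 1\<close>, and \<open>power_bound\<close> handles the other
  \<open>k - 2\<close>.\<close>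

lemma deficit_beats_entropy:
  assumes k: "3 \<le> k" and s: "2 \<le> s" and n: "2 * s * k + 38 * s ^ 4 \<le> n"
  shows "2 * (s + 1) * (n + 1) * ((s * k) choose k) \<le> ((n - s - (k - 1)) choose (k - 1))"
proof -
  define a where "a = n - s - (k - 1)"
  define l where "l = k - 1"
  define b where "b = s * k - 1"
  have s4: "s \<le> s ^ 4" using s self_le_power[of s 4] by simp
  have sk: "2 * k \<le> s * k" using s by simp
  have "s + k \<le> n"
    using n sk s4 by (simp only: mult.assoc)
  then have an: "n + 1 = a + s + k" using k unfolding a_def by simp
  \<comment> \<open>In the bound on \<open>n\<close>, \<open>k <= s * k / 2\<close> lowers the
    coefficient 2 to \<open>3 / 2\<close>, and \<open>s <= s ^ 4\<close> lowers 38 to 37.\<close>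
  have ra: "real a \<ge> 3 / 2 * real s * real k + 37 * real s ^ 4"
  proof -
    have "real n \<ge> 2 * real s * real k + 38 * real s ^ 4"
      using n by (metis (mono_tags) of_nat_add of_nat_le_iff of_nat_mult of_nat_numeral of_nat_power)
    moreover have "real n + 1 = real a + real s + real k" using an by (metis of_nat_1 of_nat_add)
    moreover have "real s \<le> real s ^ 4" using s4 by (metis of_nat_le_iff of_nat_power)
    moreover have "2 * real k \<le> real s * real k" using s by (intro mult_right_mono) auto
    ultimately show ?thesis by linarith
  qed
  have ab: "b \<le> a"
  proof -
    have "0 \<le> real s * real k" "0 \<le> real s ^ 4" by simp_all
    then have "real s * real k \<le> real a" using ra by linarith
    then have "real (s * k) \<le> real a" by simp
    then show ?thesis by (simp add: b_def del: of_nat_mult)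
  qed
  define R where "R = real a / (real s * real k)"
  have skpos: "0 < real s * real k" using s k by simp
  have R: "3 / 2 + 37 * real s ^ 3 / real k \<le> R"
  proof -
    have "(3 / 2 + 37 * real s ^ 3 / real k) * (real s * real k) = 3 / 2 * real s * real k + 37 * real s ^ 4"
      using k by (simp add: field_simps power_numeral_reduce)
    then show ?thesis using ra skpos by (simp only: R_def pos_le_divide_eq)
  qed
  have bpos: "0 < b" using sk k unfolding b_def by linarith
  have Rl: "R ^ l * real (b choose l) \<le> real (a choose l)"
  proof -
    have "R \<le> real a / real b" unfolding R_def using bpos s k
      by (intro divide_left_mono) (auto simp: b_def simp flip: of_nat_mult)
    moreover have "0 \<le> R" by (simp add: R_def)
    ultimately have "R ^ l \<le> real a ^ l / real b ^ l"
      unfolding power_divide[symmetric] by (rule power_mono)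
    then have "R ^ l * real (b choose l) \<le> real a ^ l / real b ^ l * real (b choose l)"
      by (rule mult_right_mono) simp
    also have "\<dots> = real (a ^ l * (b choose l)) / real b ^ l" by simp
    also have "\<dots> \<le> real (b ^ l * (a choose l)) / real b ^ l"
      using power_times_binomial_le[OF ab, of l] by (intro divide_right_mono) (auto simp del: of_nat_mult)
    also have "\<dots> = real (a choose l)" using bpos by simp
    finally show ?thesis .
  qed
  have Csk: "(s * k) choose k = s * (b choose l)"
  proof -
    have "k * ((s * k) choose k) = (s * k) * (b choose l)"
      using binomial_absorption[of l "s * k"] k by (simp add: l_def b_def)
    then have "k * ((s * k) choose k) = k * (s * (b choose l))" by (simp add: ac_simps)
    then show ?thesis using k by simp
  qed
  have "2 * real s * (real s + 1) * (real n + 1) \<le> R ^ l"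
  proof -
    have "real n + 1 = real a + real s + real k" using an by (metis of_nat_1 of_nat_add)
    moreover have "real s \<le> real s ^ 4" using s4 by (metis of_nat_le_iff of_nat_power)
    moreover have "2 * real k \<le> real s * real k" using s by (intro mult_right_mono) auto
    moreover have "0 \<le> real s ^ 4" by simp
    ultimately have n1: "real n + 1 \<le> 4 / 3 * real a" using ra by linarith
    \<comment> \<open>Here \<open>s + 1 <= 3 / 2 * s\<close> as \<open>2 <= s\<close>. The product
      is \<open>4 * s ^ 2 * a\<close>, which is \<open>R\<close> times the left side of
      \<open>power_bound\<close>.\<close>
    have "2 * real s * (real s + 1) * (real n + 1) \<le> 2 * real s * (3 / 2 * real s) * (4 / 3 * real a)"
      using s n1 by (intro mult_mono) auto
    also have "\<dots> = R * (4 * real s ^ 3 * real k)"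
      using skpos s k by (simp add: R_def field_simps power_numeral_reduce)
    also have "\<dots> \<le> R * (3 / 2 + 37 * real s ^ 3 / real k) ^ (k - 2)"
      using power_bound[OF k, of "real s"] s by (intro mult_left_mono) (auto simp: R_def)
    also have "\<dots> \<le> R * R ^ (k - 2)"
      using R by (intro mult_left_mono power_mono) (auto simp: R_def)
    also have "\<dots> = R ^ l"
    proof -
      have "l = Suc (k - 2)" using k by (simp add: l_def)
      then show ?thesis by simp
    qed
    finally show ?thesis .
  qed
  then have "2 * real s * (real s + 1) * (real n + 1) * real (b choose l) \<le> R ^ l * real (b choose l)"
    by (rule mult_right_mono) simp
  also note Rl
  finally have "real (2 * (s + 1) * (n + 1) * ((s * k) choose k)) \<le> real (a choose l)"
    unfolding Csk by (simp add: algebra_simps)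
  then show ?thesis unfolding a_def l_def by (simp only: of_nat_le_iff)
qed

section \<open>Counting\<close>

lemma no_matching_imp_cross_dependent:
  assumes F: "F \<subseteq> nsets V k" "0 < k" and no: "\<nexists>M. is_matching F (Suc t) M"
  shows "cross_dependent {..t} (\<lambda>_. F)"
  unfolding cross_dependent_def
proof
  assume "\<exists>f. (\<forall>u\<in>{..t}. f u \<in> F) \<and> disjoint_family_on f {..t}"
  then obtain f where f: "\<forall>u\<in>{..t}. f u \<in> F" "disjoint_family_on f {..t}" by blast
  have "inj_on f {..t}"
  proof (rule inj_onI)
    fix u v assume uv: "u \<in> {..t}" "v \<in> {..t}" "f u = f v"
    have "f u \<noteq> {}" using f(1) uv(1) F by (force simp: nsets_def)
    moreover have "f u \<inter> f v = {}" if "u \<noteq> v"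
      using f(2) uv(1,2) that by (rule disjoint_family_onD)
    ultimately show "u = v" using uv(3) by auto
  qed
  moreover have "pairwise disjnt (f ` {..t})"
  proof (rule pairwiseI)
    fix A B assume "A \<in> f ` {..t}" "B \<in> f ` {..t}" "A \<noteq> B"
    then obtain u v where uv: "u \<in> {..t}" "v \<in> {..t}" "A = f u" "B = f v" "u \<noteq> v" by auto
    then show "disjnt A B" using disjoint_family_onD[OF f(2) uv(1,2,5)] by (simp add: disjnt_def)
  qed
  ultimately have "is_matching F (Suc t) (f ` {..t})"
    using f(1) by (auto simp: is_matching_def card_image)
  then show False using no by blast
qed

lemma finite_matching_free_families: "finite (matching_free_families n k s)"
proof (rule finite_subset)
  show "matching_free_families n k s \<subseteq> Pow (nsets {1..n} k)"
    by (auto simp: matching_free_families_def)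
qed (simp add: finite_imp_finite_nsets)

section \<open>Stars and their overlaps\<close>

definition star :: "nat \<Rightarrow> nat \<Rightarrow> nat set \<Rightarrow> nat set set" where
  "star n k T = {A\<in>nsets {1..n} k. A \<inter> T \<noteq> {}}"

lemma finite_star: "finite (star n k T)"
  by (simp add: star_def finite_imp_finite_nsets)

lemma card_star:
  "T \<in> nsets {1..n} t \<Longrightarrow> card (star n k T) = (n choose k) - ((n - t) choose k)"
  using card_nsets_meeting[of "{1..n}" T k] by (simp add: star_def nsets_def)

text \<open>Pick \<open>x\<close> in \<open>T\<close> outside \<open>T'\<close>. The
  \<open>k\<close>-sets meeting \<open>insert x T'\<close> in \<open>x\<close> alone lie in the star
  of \<open>T\<close> but not in that of \<open>T'\<close>.\<close>

lemma card_star_Int: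
  assumes T: "T \<in> nsets {1..n} t" "T' \<in> nsets {1..n} t" "T \<noteq> T'" and k: "0 < k"
  shows "card (star n k T \<inter> star n k T') + ((n - Suc t) choose (k - 1))
    \<le> (n choose k) - ((n - t) choose k)"
proof -
  have T': "T \<subseteq> {1..n}" "finite T" "card T = t" "T' \<subseteq> {1..n}" "finite T'" "card T' = t"
    using T by (auto simp: nsets_def)
  then obtain x where x: "x \<in> T" "x \<notin> T'" using card_subset_eq[of T' T] T(3) by auto
  define U where "U = insert x T'"
  have U: "U \<subseteq> {1..n}" "card U = Suc t" "finite U" using x T' by (auto simp: U_def)
  let ?E = "{A\<in>nsets {1..n} k. A \<inter> U = {x}}"
  have "card ?E = card (nsets ({1..n} - U) (k - 1))"
    using card_link[of x U "nsets {1..n} k"] link_nsets[of x U "{1..n}" k] U(1) k by (simp add: U_def)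
  also have "\<dots> = (n - Suc t) choose (k - 1)"
    using U by (simp add: card_nsets card_Diff_subset)
  finally have E: "card ?E = (n - Suc t) choose (k - 1)" .
  have "?E \<inter> (star n k T \<inter> star n k T') = {}" using x(2) by (auto simp: star_def U_def)
  then have "card (star n k T \<inter> star n k T') + card ?E = card ((star n k T \<inter> star n k T') \<union> ?E)"
    using finite_star by (subst card_Un_disjoint) (auto simp: finite_imp_finite_nsets Int_commute)
  also have "\<dots> \<le> card (star n k T)"
    using x(1) by (intro card_mono finite_star) (auto simp: star_def)
  finally show ?thesis using E card_star[OF T(1)] by simp
qed

lemma subset_star_matching_free:
  assumes "T \<in> nsets {1..n} t" "F \<subseteq> star n k T"
  shows "F \<in> matching_free_families n k (Suc t)"
proof -
  have "\<not> is_matching F (Suc t) M" for M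
  proof
    assume M: "is_matching F (Suc t) M"
    have "\<exists>x. x \<in> A \<inter> T" if "A \<in> M" for A
      using that M assms(2) by (auto simp: is_matching_def star_def)
    then obtain f where f: "\<And>A. A \<in> M \<Longrightarrow> f A \<in> A \<inter> T" by metis
    have "inj_on f M"
    proof (rule inj_onI)
      fix A B assume AB: "A \<in> M" "B \<in> M" "f A = f B"
      then have "f A \<in> A \<inter> B" using f[OF AB(1)] f[OF AB(2)] by simp
      then show "A = B" using M AB unfolding is_matching_def pairwise_def disjnt_def by blast
    qed
    then have "card M \<le> card T"
      using f assms(1) by (intro card_inj_on_le[of f]) (auto simp: nsets_def)
    then show False using M assms(1) by (simp add: is_matching_def nsets_def)
  qed
  then show ?thesis using assms(2) by (auto simp: matching_free_families_def star_def)
qed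

text \<open>Truncated inclusion-exclusion: removing from \<open>P i\<close> its overlaps with the
  others costs at most \<open>card I * q\<close>, and the remainders are disjoint.\<close>

lemma card_UN_ge:
  fixes P :: "'i \<Rightarrow> 'a set"
  assumes I: "finite I" and fin: "\<And>i. i \<in> I \<Longrightarrow> finite (P i)"
    and p: "\<And>i. i \<in> I \<Longrightarrow> card (P i) = p"
    and q: "\<And>i j. i \<in> I \<Longrightarrow> j \<in> I \<Longrightarrow> i \<noteq> j \<Longrightarrow> card (P i \<inter> P j) \<le> q"
  shows "card I * p \<le> card (\<Union>i\<in>I. P i) + card I * (card I * q)"
proof -
  define Q where "Q i = P i - (\<Union>j\<in>I - {i}. P j)" for i
  have "card (\<Union>i\<in>I. Q i) = (\<Sum>i\<in>I. card (Q i))"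
    using I fin by (intro card_UN_disjoint) (auto simp: Q_def)
  moreover have "card (\<Union>i\<in>I. Q i) \<le> card (\<Union>i\<in>I. P i)"
    using I fin by (intro card_mono) (auto simp: Q_def)
  moreover have "(\<Sum>i\<in>I. p) \<le> (\<Sum>i\<in>I. card (Q i) + card I * q)"
  proof (rule sum_mono)
    fix i assume i: "i \<in> I"
    have "P i = Q i \<union> (\<Union>j\<in>I - {i}. P i \<inter> P j)" unfolding Q_def by blast
    then have "p \<le> card (Q i) + card (\<Union>j\<in>I - {i}. P i \<inter> P j)"
      using p[OF i] card_Un_le[of "Q i" "\<Union>j\<in>I - {i}. P i \<inter> P j"] by simp
    also have "card (\<Union>j\<in>I - {i}. P i \<inter> P j) \<le> (\<Sum>j\<in>I - {i}. card (P i \<inter> P j))"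
      using I by (intro card_UN_le) auto
    also have "\<dots> \<le> (\<Sum>j\<in>I - {i}. q)" using i q by (intro sum_mono) auto
    also have "\<dots> \<le> card I * q" using I by (simp add: card_Diff1_le)
    finally show "p \<le> card (Q i) + card I * q" by simp
  qed
  ultimately show ?thesis by (simp add: sum.distrib)
qed

text \<open>Encode a subfamily as a list of length \<open>c\<close>, with \<open>None\<close> as
  padding.\<close>

lemma card_small_subfamilies:
  assumes "finite X"
  shows "finite {G. G \<subseteq> X \<and> card G \<le> c}" "card {G. G \<subseteq> X \<and> card G \<le> c} \<le> (card X + 1) ^ c"
proof -
  let ?L = "{xs. set xs \<subseteq> insert None (Some ` X) \<and> length xs = c}"
  have finL: "finite ?L" using assms by (intro finite_lists_length_eq) auto
  show "finite {G. G \<subseteq> X \<and> card G \<le> c}"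
    by (rule finite_subset[of _ "Pow X"]) (use assms in auto)
  have "{G. G \<subseteq> X \<and> card G \<le> c} \<subseteq> (\<lambda>xs. {T. Some T \<in> set xs}) ` ?L"
  proof
    fix G assume "G \<in> {G. G \<subseteq> X \<and> card G \<le> c}"
    then have G: "G \<subseteq> X" "card G \<le> c" "finite G" using assms finite_subset by auto
    obtain ys where ys: "set ys = G" "distinct ys" using G(3) finite_distinct_list by blast
    define xs where "xs = map Some ys @ replicate (c - card G) None"
    have "length ys = card G" using ys distinct_card by metis
    then have "length xs = c" using G(2) by (simp add: xs_def)
    moreover have "set xs \<subseteq> insert None (Some ` X)" "{T. Some T \<in> set xs} = G"
      using ys(1) G(1) by (auto simp: xs_def)
    ultimately show "G \<in> (\<lambda>xs. {T. Some T \<in> set xs}) ` ?L" by blast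
  qed
  then have "card {G. G \<subseteq> X \<and> card G \<le> c} \<le> card ?L"
    using finL by (rule surj_card_le[rotated])
  also have "\<dots> = card (insert None (Some ` X)) ^ c"
    using assms by (intro card_lists_length_eq) auto
  also have "card (insert None (Some ` X)) = card X + 1"
    using assms by (simp add: card_image)
  finally show "card {G. G \<subseteq> X \<and> card G \<le> c} \<le> (card X + 1) ^ c" .
qed

section \<open>Maximal families as transversals of small systems\<close>

definition transversals :: "nat \<Rightarrow> nat \<Rightarrow> nat set set \<Rightarrow> nat set set" where
  "transversals n k G = {B\<in>nsets {1..n} k. \<forall>T\<in>G. B \<inter> T \<noteq> {}}"

text \<open>A \<open>k\<close>-set meeting the union of every \<open>t\<close>-matching of
  \<open>M\<close> can be added to \<open>M\<close>: a matching of size \<open>t + 1\<close> through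
  it would leave a \<open>t\<close>-matching whose union it misses.\<close>

lemma maximal_matching_free_eq_transversals:
  assumes M: "M \<in> matching_free_families n k (Suc t)" and k: "0 < k"
    and maxM: "\<And>F. F \<in> matching_free_families n k (Suc t) \<Longrightarrow> M \<subseteq> F \<Longrightarrow> F = M"
  shows "M = transversals n k {\<Union>N |N. is_matching M t N}"
proof -
  have MV: "M \<subseteq> nsets {1..n} k" and no: "\<nexists>N. is_matching M (Suc t) N"
    using M by (auto simp: matching_free_families_def)
  show ?thesis
  proof (intro equalityI subsetI)
    fix B assume B: "B \<in> M"
    have "B \<inter> \<Union>N \<noteq> {}" if N: "is_matching M t N" for N
    proof
      assume disj: "B \<inter> \<Union>N = {}"
      have "B \<noteq> {}" using B MV k by (auto simp: nsets_def)
      then have "B \<notin> N" using disj by blast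
      then have "is_matching M (Suc t) (insert B N)"
        using N B disj by (auto simp: is_matching_def pairwise_insert disjnt_def)
      then show False using no by blast
    qed
    then show "B \<in> transversals n k {\<Union>N |N. is_matching M t N}"
      using B MV by (auto simp: transversals_def)
  next
    fix B assume B: "B \<in> transversals n k {\<Union>N |N. is_matching M t N}"
    show "B \<in> M"
    proof (rule ccontr)
      assume BM: "B \<notin> M"
      then have "insert B M \<notin> matching_free_families n k (Suc t)" using maxM by blast
      then obtain N where N: "is_matching (insert B M) (Suc t) N"
        using B MV by (auto simp: matching_free_families_def transversals_def)
      have "B \<in> N"
      proof (rule ccontr)
        assume "B \<notin> N"
        then have "is_matching M (Suc t) N" using N by (auto simp: is_matching_def)
        then show False using no by blast
      qed
      then have "is_matching M t (N - {B})"
        using N by (auto simp: is_matching_def intro: pairwise_subset)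
      then have "B \<inter> \<Union>(N - {B}) \<noteq> {}" using B by (auto simp: transversals_def)
      then show False using N \<open>B \<in> N\<close> by (auto simp: is_matching_def pairwise_def disjnt_def)
    qed
  qed
qed

text \<open>Take the fewest unions that still define \<open>M\<close>. By minimality each such
  \<open>T\<close> has a witness \<open>B T\<close>, a \<open>k\<close>-set missing \<open>T\<close>
  and meeting all the others. These form a set-pair system with sizes \<open>k\<close> and
  \<open>t * k\<close>.\<close>

lemma maximal_matching_free_generated:
  assumes M: "M \<in> matching_free_families n k (Suc t)" and k: "0 < k"
    and maxM: "\<And>F. F \<in> matching_free_families n k (Suc t) \<Longrightarrow> M \<subseteq> F \<Longrightarrow> F = M"
  shows "\<exists>G. G \<subseteq> Pow {1..n} \<and> card G \<le> (Suc t * k) choose k \<and> M = transversals n k G"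
proof -
  define TT where "TT = {\<Union>N |N. is_matching M t N}"
  have MV: "M \<subseteq> nsets {1..n} k" using M by (auto simp: matching_free_families_def)
  have TT: "T \<in> nsets {1..n} (t * k)" if T: "T \<in> TT" for T
  proof -
    obtain N where N: "is_matching M t N" "T = \<Union>N" using T by (auto simp: TT_def)
    then have sets: "A \<subseteq> {1..n}" "finite A" "card A = k" if "A \<in> N" for A
      using that MV by (auto simp: is_matching_def nsets_def)
    have "card (\<Union>N) = (\<Sum>A\<in>N. card A)"
      using N sets by (intro card_Union_disjoint) (auto simp: is_matching_def)
    also have "\<dots> = t * k" using sets N by (simp add: is_matching_def)
    finally show ?thesis using N sets by (auto simp: nsets_def is_matching_def)
  qed
  define P where "P G \<longleftrightarrow> G \<subseteq> TT \<and> M = transversals n k G" for G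
  have "M = transversals n k TT"
    unfolding TT_def by (rule maximal_matching_free_eq_transversals[OF M k maxM])
  then have "P TT" by (simp add: P_def)
  then obtain G where "P G" and minG: "\<And>G'. P G' \<Longrightarrow> card G \<le> card G'"
    using ex_has_least_nat[of P TT card] by metis
  then have G: "G \<subseteq> TT" "M = transversals n k G" by (simp_all add: P_def)
  have "TT \<subseteq> nsets {1..n} (t * k)" using TT by blast
  then have finG: "finite G" using G(1) by (meson finite_atLeastAtMost finite_imp_finite_nsets finite_subset)
  have "\<exists>B\<in>nsets {1..n} k. B \<inter> T = {} \<and> (\<forall>T'\<in>G - {T}. B \<inter> T' \<noteq> {})" if T: "T \<in> G" for T
  proof -
    have "card (G - {T}) < card G" using finG T by (rule card_Diff1_less)
    then have "M \<noteq> transversals n k (G - {T})" using minG[of "G - {T}"] G(1) by (auto simp: P_def)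
    then show ?thesis using G(2) by (auto simp: transversals_def)
  qed
  then obtain B where B: "\<And>T. T \<in> G \<Longrightarrow> B T \<in> nsets {1..n} k \<and> B T \<inter> T = {} \<and> (\<forall>T'\<in>G - {T}. B T \<inter> T' \<noteq> {})"
    by metis
  have "card G \<le> (k + t * k) choose k"
    by (rule Bollobas_set_pairs[of "{1..n}" G B k "\<lambda>T. T" "t * k"]) (use finG B TT G(1) in auto)
  moreover have "G \<subseteq> Pow {1..n}" using G(1) TT by (auto simp: nsets_def)
  ultimately show ?thesis using G(2) by auto
qed

section \<open>Counting uncovered and covered families\<close>

text \<open>Union bound: at most \<open>2 ^ ((n + 1) * C)\<close> maximal families, each with at
  most \<open>2 ^ (N - 2 * (n + 1) * C)\<close> subfamilies. As \<open>1 <= C\<close>, the saving in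
  the exponent is at least \<open>n\<close>.\<close>

lemma card_uncovered_matching_free:
  assumes k: "3 \<le> k" and t: "0 < t" and n: "2 * Suc t * k + 38 * Suc t ^ 4 \<le> n"
  shows "card {F\<in>matching_free_families n k (Suc t). \<forall>T\<in>nsets {1..n} t. \<exists>A\<in>F. A \<inter> T = {}} * 2 ^ n
    \<le> 2 ^ ((n choose k) - ((n - t) choose k))"
proof -
  define N where "N = (n choose k) - ((n - t) choose k)"
  define C where "C = (Suc t * k) choose k"
  define MF where "MF = matching_free_families n k (Suc t)"
  define NT where "NT = {F\<in>MF. \<forall>T\<in>nsets {1..n} t. \<exists>A\<in>F. A \<inter> T = {}}"
  \<comment> \<open>Maximality is meant in all of \<open>MF\<close>, as
    \<open>maximal_matching_free_generated\<close> demands. Families containing an uncovered one are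
    uncovered, so \<open>Mx\<close> still dominates \<open>NT\<close>.\<close>
  define Mx where "Mx = {M\<in>NT. \<forall>F\<in>MF. M \<subseteq> F \<longrightarrow> F = M}"
  have finMF: "finite MF" by (simp add: MF_def finite_matching_free_families)
  have "1 \<le> C" by (simp add: C_def Suc_leI)
  have Mx_le: "card M + 2 * (n + 1) * C \<le> N" if "M \<in> Mx" for M
  proof -
    have M: "M \<in> MF" "\<And>T. T \<in> nsets {1..n} t \<Longrightarrow> \<exists>A\<in>M. A \<inter> T = {}"
      using that by (auto simp: Mx_def NT_def)
    then have MV: "M \<subseteq> nsets {1..n} k" "\<nexists>N. is_matching M (Suc t) N"
      by (auto simp: MF_def matching_free_families_def)
    have cd: "cross_dependent {..t} (\<lambda>_. M)"
      using k by (intro no_matching_imp_cross_dependent[OF MV(1) _ MV(2)]) simp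
    have "(2 * t + 2) * (k - 1) + Suc t \<le> n"
    proof -
      have "(2 * t + 2) * (k - 1) + (2 * t + 2) = 2 * Suc t * k" using k by (cases k) auto
      then show ?thesis using n by linarith
    qed
    then have "(t + 2) * card M + ((n - Suc t - (k - 1)) choose (k - 1)) \<le> (t + 2) * N"
      unfolding N_def using k M(2) by (intro uncovered_deficit[OF MV(1) cd t]) simp_all
    moreover have "2 * (Suc t + 1) * (n + 1) * C \<le> (n - Suc t - (k - 1)) choose (k - 1)"
      unfolding C_def using k t n by (intro deficit_beats_entropy) auto
    moreover have "2 * (Suc t + 1) * (n + 1) * C = (t + 2) * (2 * (n + 1) * C)"
      by (simp add: algebra_simps)
    ultimately have "(t + 2) * card M + (t + 2) * (2 * (n + 1) * C) \<le> (t + 2) * N" by linarith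
    then have "(t + 2) * (card M + 2 * (n + 1) * C) \<le> (t + 2) * N" by (simp only: add_mult_distrib2)
    then show ?thesis by (simp only: mult_le_cancel1)
  qed
  have finMx: "finite Mx" using finMF by (simp add: Mx_def NT_def)
  have card_Mx: "card Mx \<le> 2 ^ ((n + 1) * C)"
  proof -
    let ?S = "{G. G \<subseteq> Pow {1..n} \<and> card G \<le> C}"
    have "Mx \<subseteq> transversals n k ` ?S"
    proof
      fix M assume "M \<in> Mx"
      then have "\<exists>G. G \<subseteq> Pow {1..n} \<and> card G \<le> C \<and> M = transversals n k G"
        unfolding C_def using k
        by (intro maximal_matching_free_generated) (auto simp: Mx_def NT_def MF_def)
      then show "M \<in> transversals n k ` ?S" by blast
    qed
    then have "card Mx \<le> card ?S" by (rule surj_card_le[rotated]) (simp add: card_small_subfamilies)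
    also have "\<dots> \<le> (card (Pow {1..n}) + 1) ^ C" by (intro card_small_subfamilies) simp
    also have "\<dots> \<le> (2 ^ (n + 1)) ^ C" by (intro power_mono) (simp_all add: card_Pow)
    finally show ?thesis by (simp only: power_mult)
  qed
  have "NT \<subseteq> (\<Union>M\<in>Mx. Pow M)"
  proof
    fix F assume F: "F \<in> NT"
    then have "F \<in> MF" by (simp add: NT_def)
    from finite_has_maximal2[OF finMF this] obtain M
      where M: "M \<in> MF" "F \<subseteq> M" "\<forall>F'\<in>MF. M \<subseteq> F' \<longrightarrow> M = F'" by blast
    have "M \<in> NT" using F M(1,2) unfolding NT_def by blast
    then have "M \<in> Mx" using M(3) unfolding Mx_def by blast
    then show "F \<in> (\<Union>M\<in>Mx. Pow M)" using M(2) by blast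
  qed
  moreover have finM: "finite M" if "M \<in> Mx" for M
  proof (rule finite_subset)
    show "M \<subseteq> nsets {1..n} k"
      using that by (simp add: Mx_def NT_def MF_def matching_free_families_def)
  qed (simp add: finite_imp_finite_nsets)
  ultimately have "card NT \<le> card (\<Union>M\<in>Mx. Pow M)"
    using finMx by (intro card_mono) auto
  also have "\<dots> \<le> (\<Sum>M\<in>Mx. card (Pow M))" using finMx by (rule card_UN_le)
  finally have "card NT * 2 ^ (2 * (n + 1) * C) \<le> (\<Sum>M\<in>Mx. card (Pow M)) * 2 ^ (2 * (n + 1) * C)"
    by (rule mult_le_mono1)
  also have "\<dots> = (\<Sum>M\<in>Mx. 2 ^ (card M + 2 * (n + 1) * C))"
    unfolding sum_distrib_right using finM by (intro sum.cong refl) (simp add: card_Pow power_add)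
  also have "\<dots> \<le> (\<Sum>M\<in>Mx. 2 ^ N)" using Mx_le by (intro sum_mono power_increasing) auto
  also have "\<dots> \<le> 2 ^ ((n + 1) * C) * 2 ^ N" using card_Mx by simp
  finally have "card NT * 2 ^ (2 * (n + 1) * C) \<le> 2 ^ ((n + 1) * C) * 2 ^ N" .
  moreover have "2 * (n + 1) * C = (n + 1) * C + (n + 1) * C" by simp
  ultimately have "2 ^ ((n + 1) * C) * (card NT * 2 ^ ((n + 1) * C)) \<le> 2 ^ ((n + 1) * C) * 2 ^ N"
    by (simp only: power_add[of _ "(n + 1) * C"] mult.left_commute)
  then have le: "card NT * 2 ^ ((n + 1) * C) \<le> 2 ^ N" by simp
  have "n \<le> (n + 1) * C" using \<open>1 \<le> C\<close> by (metis le_add1 le_trans mult.right_neutral mult_le_mono2)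
  then have "card NT * 2 ^ n \<le> card NT * 2 ^ ((n + 1) * C)"
    by (intro mult_le_mono2 power_increasing) auto
  also note le
  finally show ?thesis by (simp only: NT_def MF_def N_def)
qed

lemma card_covered_matching_free:
  assumes k: "3 \<le> k" and t: "0 < t" and n: "2 * Suc t * k + 38 * Suc t ^ 4 \<le> n"
  defines "N \<equiv> (n choose k) - ((n - t) choose k)"
  shows "card (\<Union>T\<in>nsets {1..n} t. Pow (star n k T)) \<le> (n choose t) * 2 ^ N"
    and "(n choose t) * 2 ^ N * 2 ^ n \<le> card (\<Union>T\<in>nsets {1..n} t. Pow (star n k T)) * 2 ^ n + 2 ^ N"
proof -
  let ?I = "nsets {1..n} t"
  have finI: "finite ?I" by (simp add: finite_imp_finite_nsets)
  have cI: "card ?I = n choose t" by (simp add: card_nsets)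
  have cP: "card (Pow (star n k T)) = 2 ^ N" if "T \<in> ?I" for T
    using that by (simp add: card_Pow finite_star card_star N_def)
  have "card (\<Union>T\<in>?I. Pow (star n k T)) \<le> (\<Sum>T\<in>?I. card (Pow (star n k T)))"
    using finI by (rule card_UN_le)
  then show "card (\<Union>T\<in>?I. Pow (star n k T)) \<le> (n choose t) * 2 ^ N" using cP cI by simp
  \<comment> \<open>The \<open>3 * n\<close> pays for two factors \<open>n choose t\<close>, each at
    most \<open>2 ^ n\<close>, and for the factor \<open>2 ^ n\<close> in the claim.\<close>
  have big: "3 * n \<le> (n - Suc t) choose (k - 1)"
  proof -
    have "1 \<le> (Suc t * k) choose k" by (simp add: Suc_leI)
    then have "2 * (Suc t + 1) * (n + 1) * 1 \<le> 2 * (Suc t + 1) * (n + 1) * ((Suc t * k) choose k)"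
      by (rule mult_le_mono2)
    also have "\<dots> \<le> (n - Suc t - (k - 1)) choose (k - 1)"
      using k t n by (intro deficit_beats_entropy) auto
    also have "\<dots> \<le> (n - Suc t) choose (k - 1)" by (intro binomial_right_mono) simp
    finally show ?thesis by simp
  qed
  have q: "card (Pow (star n k T) \<inter> Pow (star n k T')) \<le> 2 ^ (N - 3 * n)"
    if "T \<in> ?I" "T' \<in> ?I" "T \<noteq> T'" for T T'
  proof -
    have "card (star n k T \<inter> star n k T') \<le> N - 3 * n"
      using card_star_Int[OF that, of k] k big by (simp add: N_def)
    then show ?thesis by (simp add: card_Pow finite_star flip: Pow_Int_eq)
  qed
  have "card ?I * 2 ^ N \<le> card (\<Union>T\<in>?I. Pow (star n k T)) + card ?I * (card ?I * 2 ^ (N - 3 * n))"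
    by (rule card_UN_ge[OF finI _ cP q]) (simp_all add: finite_star)
  then have "(n choose t) * 2 ^ N * 2 ^ n
      \<le> (card (\<Union>T\<in>?I. Pow (star n k T)) + (n choose t) * ((n choose t) * 2 ^ (N - 3 * n))) * 2 ^ n"
    unfolding cI by (rule mult_le_mono1)
  moreover have "(n choose t) * ((n choose t) * 2 ^ (N - 3 * n)) * 2 ^ n \<le> 2 ^ N"
  proof -
    have "Suc t * 1 \<le> (2 * Suc t) * k" using k by (intro mult_le_mono) auto
    also have "\<dots> \<le> n" using n by (rule add_leD1)
    finally have "t < n" by simp
    \<comment> \<open>This guards against truncation in \<open>N - 3 * n\<close>. Two distinct
      \<open>t\<close>-sets exist because \<open>0 < t < n\<close>.\<close>
    have "3 * n \<le> N"
    proof -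
      have t1: "{1..t} \<in> ?I" using \<open>t < n\<close> by (auto simp: nsets_def)
      have t2: "{2..Suc t} \<in> ?I" using \<open>t < n\<close> by (auto simp: nsets_def)
      have "(1::nat) \<in> {1..t}" "(1::nat) \<notin> {2..Suc t}" using t by auto
      then have "{1..t} \<noteq> {2..Suc t}" by blast
      then show ?thesis using card_star_Int[OF t1 t2, of k] k big by (simp add: N_def)
    qed
    have "(n choose t) * ((n choose t) * 2 ^ (N - 3 * n)) * 2 ^ n
        \<le> 2 ^ n * (2 ^ n * 2 ^ (N - 3 * n)) * 2 ^ n"
      by (intro mult_le_mono binomial_le_pow2) auto
    also have "\<dots> = 2 ^ N" using \<open>3 * n \<le> N\<close> by (simp flip: power_add)
    finally show ?thesis .
  qed
  ultimately show "(n choose t) * 2 ^ N * 2 ^ n \<le> card (\<Union>T\<in>?I. Pow (star n k T)) * 2 ^ n + 2 ^ N"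
    unfolding add_mult_distrib by linarith
qed

text \<open>Uncovered families cause the upper error and overlaps of stars the lower one. They act
  in opposite directions, so each may use up the whole \<open>1 / 2 ^ n\<close>.\<close>

lemma matching_free_count_error:
  assumes k: "3 \<le> k" and s: "2 \<le> s" and n: "2 * s * k + 38 * s ^ 4 \<le> n"
  defines "N \<equiv> (n choose k) - ((n - s + 1) choose k)"
  shows "\<bar>real (card (matching_free_families n k s)) / 2 ^ N - real (n choose (s - 1))\<bar> \<le> 1 / 2 ^ n"
proof -
  obtain t where t: "s = Suc t" "0 < t" using s by (cases s) auto
  have "Suc t \<le> n"
  proof -
    have "s \<le> 2 * s * k" using k by simp
    then show ?thesis using n t(1) by linarith
  qed
  \<comment> \<open>With truncated subtraction, \<open>n - s + 1 = n - t\<close> relies on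
    \<open>Suc t <= n\<close>.\<close>
  then have N: "N = (n choose k) - ((n - t) choose k)" by (simp add: N_def t(1) Suc_diff_Suc)
  note n' = n[unfolded t(1)]
  define NT where "NT = {F\<in>matching_free_families n k s. \<forall>T\<in>nsets {1..n} t. \<exists>A\<in>F. A \<inter> T = {}}"
  define TR where "TR = (\<Union>T\<in>nsets {1..n} t. Pow (star n k T))"
  have "matching_free_families n k s = TR \<union> NT"
  proof (intro equalityI subsetI)
    fix F assume F: "F \<in> matching_free_families n k s"
    show "F \<in> TR \<union> NT"
    proof (cases "F \<in> NT")
      case False
      then obtain T where T: "T \<in> nsets {1..n} t" "\<forall>A\<in>F. A \<inter> T \<noteq> {}"
        using F unfolding NT_def by blast
      have "F \<subseteq> nsets {1..n} k" using F by (simp add: matching_free_families_def)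
      then have "F \<subseteq> star n k T" using T(2) unfolding star_def by blast
      then show ?thesis using T(1) unfolding TR_def by blast
    qed simp
  next
    fix F assume "F \<in> TR \<union> NT"
    then show "F \<in> matching_free_families n k s"
      using subset_star_matching_free t(1) by (auto simp: TR_def NT_def)
  qed
  moreover have "TR \<inter> NT = {}"
  proof -
    have "F \<notin> NT" if "F \<in> TR" for F
      using that unfolding TR_def NT_def star_def by blast
    then show ?thesis by blast
  qed
  moreover have "finite TR" "finite NT"
    using finite_matching_free_families by (auto simp: TR_def NT_def finite_imp_finite_nsets finite_star)
  ultimately have total: "card (matching_free_families n k s) = card TR + card NT"
    by (simp add: card_Un_disjoint)
  define c where "c = real (card (matching_free_families n k s))"
  have NT: "real (card NT) * 2 ^ n \<le> 2 ^ N"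
    using card_uncovered_matching_free[OF k t(2) n'] unfolding N NT_def t(1)
    by (metis (mono_tags, lifting) of_nat_le_iff of_nat_mult of_nat_numeral of_nat_power)
  have TR1: "real (card TR) \<le> real (n choose t) * 2 ^ N"
    using card_covered_matching_free(1)[OF k t(2) n'] unfolding N TR_def
    by (metis (mono_tags, lifting) of_nat_le_iff of_nat_mult of_nat_numeral of_nat_power)
  have TR2: "real (n choose t) * 2 ^ N * 2 ^ n \<le> real (card TR) * 2 ^ n + 2 ^ N"
    using card_covered_matching_free(2)[OF k t(2) n'] unfolding N TR_def
    by (metis (mono_tags, lifting) of_nat_add of_nat_le_iff of_nat_mult of_nat_numeral of_nat_power)
  have c: "c = real (card TR) + real (card NT)" by (simp add: c_def total)
  have "c * 2 ^ n \<le> real (n choose t) * 2 ^ N * 2 ^ n + 2 ^ N"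
    unfolding c distrib_right using TR1 NT by (intro add_mono mult_right_mono) auto
  moreover have "real (n choose t) * 2 ^ N * 2 ^ n \<le> c * 2 ^ n + 2 ^ N"
  proof -
    have "0 \<le> real (card NT) * 2 ^ n" by simp
    then show ?thesis using TR2 unfolding c distrib_right by linarith
  qed
  ultimately have "\<bar>c / 2 ^ N - real (n choose t)\<bar> \<le> 1 / 2 ^ n"
    unfolding abs_le_iff by (simp add: field_simps)
  then show ?thesis by (simp add: c_def t(1))
qed

theorem theorem1p5:
  shows "\<exists>(\<epsilon> :: nat \<Rightarrow> nat \<Rightarrow> nat \<Rightarrow> real) (\<delta> :: nat \<Rightarrow> real).
    \<delta> \<longlonglongrightarrow> 0 \<and>
    (\<forall>n k s :: nat. 3 \<le> k \<longrightarrow> 2 \<le> s \<longrightarrow> 2 * s * k + 38 * s ^ 4 \<le> n \<longrightarrow>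
       \<bar>\<epsilon> n k s\<bar> \<le> \<delta> n \<and>
       real (card (matching_free_families n k s)) =
         (real (n choose (s - 1)) + \<epsilon> n k s)
           * 2 ^ ((n choose k) - ((n - s + 1) choose k)))"
proof (intro exI conjI allI impI)
  \<comment> \<open>The goals shown instantiate the witnesses: \<open>\<delta> n\<close> is
    \<open>1 / 2 ^ n\<close>, and \<open>\<epsilon>\<close> is the normalised count minus the
    binomial coefficient.\<close>
  show "(\<lambda>n. 1 / 2 ^ n :: real) \<longlonglongrightarrow> 0"
    using LIMSEQ_realpow_zero[of "1 / 2 :: real"] by (simp add: power_divide)
  fix n k s :: nat assume *: "3 \<le> k" "2 \<le> s" "2 * s * k + 38 * s ^ 4 \<le> n"
  show "\<bar>real (card (matching_free_families n k s)) / 2 ^ ((n choose k) - ((n - s + 1) choose k))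
      - real (n choose (s - 1))\<bar> \<le> 1 / 2 ^ n"
    using * by (rule matching_free_count_error)
qed simp

end
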